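(* Let $V=\mathbb{C}^{2n}$ with a symplectic form $\omega$, and let $X\subset \mathbb{P}(V)=\mathbb{P}^{2n-1}$ be an irreducible smooth Legendrian subvariety which is not a linear subspace. Let $G<\mathbb{P}\mathrm{GL}_{2n}$ be a connected subgroup preserving $X$. Then $G$ is contained in the image of the natural map $\mathrm{Sp}_{2n}\to \mathbb{P}\mathrm{GL}_{2n}$.
   Context: Everything is over $\mathbb{C}$. A subvariety $X\subset\mathbb{P}(V)$ is Legendrian (with respect to $\omega$) if for each smooth point of its affine cone $\hat X\subset V$ the tangent space to $\hat X$ at this point is a Lagrangian subspace of $V$, i.e. maximal isotropic with respect to $\omega$. $\mathrm{Sp}_{2n}$ is the group of linear automorphisms of $V$ preserving $\omega$. *)

theory Defs
  imports
    "HOL-Analysis.Analysis"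
    "HOL-Library.Poly_Mapping"
    "HOL-Library.Extended_Nat"
    "HOL-Algebra.Coset"
begin

section \<open>Polynomials in finitely many variables\<close>

text \<open>
  A polynomial over \<open>\<complex>\<close> in the variables indexed by \<open>'i\<close> is a finitely supported map
  from monomials to coefficients, a monomial being a finitely supported exponent vector.
\<close>

type_synonym 'i cpoly = "('i \<Rightarrow>\<^sub>0 nat) \<Rightarrow>\<^sub>0 complex"

definition poly_eval :: "'i cpoly \<Rightarrow> ('i \<Rightarrow> complex) \<Rightarrow> complex" where
  "poly_eval p v =
     (\<Sum>m\<in>Poly_Mapping.keys p. Poly_Mapping.lookup p m *
        (\<Prod>i\<in>Poly_Mapping.keys m. v i ^ Poly_Mapping.lookup m i))"

definition homogeneous :: "'i cpoly \<Rightarrow> bool" where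
  "homogeneous p \<longleftrightarrow>
     (\<exists>d. \<forall>m\<in>Poly_Mapping.keys p.
        (\<Sum>i\<in>Poly_Mapping.keys m. Poly_Mapping.lookup m i) = d)"

abbreviation vec_eval :: "'m cpoly \<Rightarrow> complex^'m \<Rightarrow> complex" where
  "vec_eval p v \<equiv> poly_eval p (\<lambda>i. v $ i)"

abbreviation mat_eval :: "('m \<times> 'm) cpoly \<Rightarrow> complex^'m^'m \<Rightarrow> complex" where
  "mat_eval p A \<equiv> poly_eval p (\<lambda>(i, j). A $ i $ j)"


section \<open>Zariski topology and local dimension\<close>

definition irreducible_in :: "'a topology \<Rightarrow> 'a set \<Rightarrow> bool" where
  "irreducible_in T S \<longleftrightarrow> S \<subseteq> topspace T \<and> S \<noteq> {} \<and>
     (\<forall>A B. closedin T A \<and> closedin T B \<and> S \<subseteq> A \<union> B \<longrightarrow> S \<subseteq> A \<or> S \<subseteq> B)"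

text \<open>
  The Zariski topologies are generated by the principal open sets (non-vanishing loci of single
  polynomials); their closed sets are the common zero sets of families of polynomials.
\<close>

definition zariski_affine :: "(complex^'m) topology" where
  "zariski_affine = topology_generated_by {{v. vec_eval p v \<noteq> 0} | p. True}"

text \<open>
  The Krull dimension of the local ring of the closed set \<open>Z\<close> at its point \<open>x\<close>: prime ideals of
  that ring correspond to the irreducible closed subsets of \<open>Z\<close> through \<open>x\<close>.
\<close>

definition local_dim :: "(complex^'m) set \<Rightarrow> complex^'m \<Rightarrow> enat" where
  "local_dim Z x =
     Sup {enat k | k. \<exists>C :: nat \<Rightarrow> (complex^'m) set.
        (\<forall>i\<le>k. closedin zariski_affine (C i) \<and> irreducible_in zariski_affine (C i) \<and>
               x \<in> C i \<and> C i \<subseteq> Z) \<and>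
        (\<forall>i<k. C i \<subset> C (Suc i))}"

definition vanishing_ideal :: "(complex^'m) set \<Rightarrow> 'm cpoly set" where
  "vanishing_ideal Z = {p. \<forall>v\<in>Z. vec_eval p v = 0}"

text \<open>The Zariski tangent space: the common kernel of the differentials at \<open>x\<close> of all
  polynomials vanishing on \<open>Z\<close>.\<close>

definition tangent_space :: "(complex^'m) set \<Rightarrow> complex^'m \<Rightarrow> (complex^'m) set" where
  "tangent_space Z x =
     {w. \<forall>p\<in>vanishing_ideal Z.
        ((\<lambda>t. vec_eval p (x + t *s w)) has_field_derivative 0) (at 0)}"

text \<open>Regularity of the local ring of \<open>Z\<close> at \<open>x\<close>. Note that \<open>vec.dim\<close> is the dimension over \<open>\<complex>\<close>.\<close>

definition smooth_point :: "(complex^'m) set \<Rightarrow> complex^'m \<Rightarrow> bool" where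
  "smooth_point Z x \<longleftrightarrow> x \<in> Z \<and> enat (vec.dim (tangent_space Z x)) = local_dim Z x"


section \<open>Projective space and its subvarieties\<close>

text \<open>The points of \<open>\<P>(W)\<close> are the one-dimensional linear subspaces of \<open>W\<close>.\<close>

definition proj :: "(complex^'m) set \<Rightarrow> (complex^'m) set set" where
  "proj W = {vec.span {v} | v. v \<in> W \<and> v \<noteq> 0}"

definition zariski_proj :: "(complex^'m) set topology" where
  "zariski_proj =
     topology_generated_by
       {{vec.span {v} | v. v \<noteq> 0 \<and> vec_eval p v \<noteq> 0} | p. homogeneous p}"

definition affine_cone :: "(complex^'m) set set \<Rightarrow> (complex^'m) set" where
  "affine_cone X = insert 0 (\<Union>X)"

definition subvariety :: "(complex^'m) set set \<Rightarrow> bool" where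
  "subvariety X \<longleftrightarrow> closedin zariski_proj X"

text \<open>
  Smoothness of \<open>X\<close> is read off from the affine cone away from its vertex, which is a
  Zariski-locally trivial \<open>\<complex>\<^sup>*\<close>-bundle over \<open>X\<close>.
\<close>

definition smooth_subvariety :: "(complex^'m) set set \<Rightarrow> bool" where
  "smooth_subvariety X \<longleftrightarrow> (\<forall>x\<in>affine_cone X - {0}. smooth_point (affine_cone X) x)"

definition linear_subvariety :: "(complex^'m) set set \<Rightarrow> bool" where
  "linear_subvariety X \<longleftrightarrow> (\<exists>W. vec.subspace W \<and> X = proj W)"


section \<open>Symplectic forms and Legendrian subvarieties\<close>

definition symplectic_form :: "(complex^'m \<Rightarrow> complex^'m \<Rightarrow> complex) \<Rightarrow> bool" where
  "symplectic_form \<omega> \<longleftrightarrow>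
     (\<forall>u. Vector_Spaces.linear (*s) (*) (\<lambda>v. \<omega> u v)) \<and>
     (\<forall>v. Vector_Spaces.linear (*s) (*) (\<lambda>u. \<omega> u v)) \<and>
     (\<forall>v. \<omega> v v = 0) \<and>
     (\<forall>u. (\<forall>v. \<omega> u v = 0) \<longrightarrow> u = 0)"

definition isotropic ::
  "(complex^'m \<Rightarrow> complex^'m \<Rightarrow> complex) \<Rightarrow> (complex^'m) set \<Rightarrow> bool" where
  "isotropic \<omega> W \<longleftrightarrow> vec.subspace W \<and> (\<forall>u\<in>W. \<forall>v\<in>W. \<omega> u v = 0)"

definition lagrangian ::
  "(complex^'m \<Rightarrow> complex^'m \<Rightarrow> complex) \<Rightarrow> (complex^'m) set \<Rightarrow> bool" where
  "lagrangian \<omega> W \<longleftrightarrow> isotropic \<omega> W \<and> (\<forall>W'. isotropic \<omega> W' \<and> W \<subseteq> W' \<longrightarrow> W' = W)"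

definition legendrian ::
  "(complex^'m \<Rightarrow> complex^'m \<Rightarrow> complex) \<Rightarrow> (complex^'m) set set \<Rightarrow> bool" where
  "legendrian \<omega> X \<longleftrightarrow> subvariety X \<and>
     (\<forall>x. smooth_point (affine_cone X) x \<longrightarrow> lagrangian \<omega> (tangent_space (affine_cone X) x))"


section \<open>Linear groups\<close>

definition GL :: "(complex^'m^'m) monoid" where
  "GL = \<lparr>carrier = {A. invertible A}, monoid.mult = (**), one = mat 1\<rparr>"

definition scalars :: "(complex^'m^'m) set" where
  "scalars = {mat c | c. c \<noteq> 0}"

definition PGL :: "(complex^'m^'m) set monoid" where
  "PGL = GL Mod scalars"

text \<open>The Zariski topology on \<open>PGL\<close> as an open subset of the projective space of matrices.\<close>

definition zariski_PGL :: "(complex^'m^'m) set topology" where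
  "zariski_PGL =
     topology_generated_by
       {{K \<in> carrier PGL. \<exists>A\<in>K. mat_eval p A \<noteq> 0} | p. homogeneous p}"

text \<open>The action on lines; all representatives \<open>A \<in> K\<close> of an element of \<open>PGL\<close> map a line \<open>L\<close> onto
  the same line.\<close>

definition PGL_act ::
  "(complex^'m^'m) set \<Rightarrow> (complex^'m) set \<Rightarrow> (complex^'m) set" where
  "PGL_act K L = {A *v v | A v. A \<in> K \<and> v \<in> L}"

definition preserves :: "(complex^'m^'m) set set \<Rightarrow> (complex^'m) set set \<Rightarrow> bool" where
  "preserves G X \<longleftrightarrow> (\<forall>K\<in>G. PGL_act K ` X = X)"

definition Sp :: "(complex^'m \<Rightarrow> complex^'m \<Rightarrow> complex) \<Rightarrow> (complex^'m^'m) set" where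
  "Sp \<omega> = {A. invertible A \<and> (\<forall>u v. \<omega> (A *v u) (A *v v) = \<omega> u v)}"

definition to_PGL :: "complex^'m^'m \<Rightarrow> (complex^'m^'m) set" where
  "to_PGL A = scalars #>\<^bsub>GL\<^esub> A"

end

theory Submission
  imports Defs "HOL-Computational_Algebra.Fundamental_Theorem_Algebra"
begin

text \<open>
  Let \<open>Z\<close> be the affine cone of \<open>X\<close>, write \<open>T z\<close> for its tangent space at \<open>z\<close>, and let the linear map
  \<open>g\<close> represent an element of \<open>G\<close>. As \<open>g\<close> preserves \<open>Z\<close>, all tangent spaces are isotropic both for \<open>\<omega>\<close>
  and for the pulled back form \<open>\<omega> (g u) (g v) = \<omega> (B u) v\<close>. Equivalently, \<open>B\<close> is self-adjoint for \<open>\<omega>\<close>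
  and maps every \<open>T z\<close> to itself. The theorem follows once \<open>B\<close> is known to be a scalar
  (\<open>compatible_scalar\<close>), because then a multiple of \<open>g\<close> is symplectic.

  Suppose that \<open>B\<close> is not scalar. A polynomial \<open>E\<close> in \<open>B\<close> then satisfies \<open>E\<^sup>2 = c E\<close> without being a
  scalar (\<open>quadratic_in_algebra\<close>), and \<open>E\<close> inherits the properties of \<open>B\<close>. Since \<open>z \<in> T z\<close>, the linear
  vector field \<open>E\<close> is tangent to \<open>Z\<close>, so its flow preserves \<open>Z\<close>, and \<open>s z + E z\<close> lies in \<open>Z\<close> for all \<open>s\<close>
  (\<open>orb_in_Z\<close>). All these points have the same tangent space \<open>T z\<close>, including the limit point \<open>E z\<close> if
  it is not \<open>0\<close> (\<open>tangent_orb\<close>).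

  The second fundamental form of \<open>Z\<close> at \<open>z\<close> is a cubic form on \<open>T z\<close>, for which \<open>E\<close> is symmetric
  (\<open>hessian_exchange\<close>). Transporting it along the invertible maps \<open>s + E\<close> and letting \<open>s\<close> tend to \<open>0\<close>,
  where it stays finite because \<open>E z\<close> is a smooth point, shows that it vanishes at every \<open>z\<close> with
  \<open>E z \<noteq> 0\<close> and \<open>E z \<noteq> c z\<close> (\<open>hessian_limit\<close>, \<open>generic_flat\<close>). Such points exist: \<open>X\<close> is irreducible, and \<open>Z\<close>
  is contained in no hyperplane, because a Legendrian cone in a hyperplane is linear
  (\<open>degenerate_linear\<close>). As the second fundamental form vanishes at all these points, so do the higher
  derivatives along the tangent space of all functions in the ideal (\<open>iterated_flat\<close>), whence
  \<open>T z \<subseteq> Z\<close> by Taylor's formula. Comparing dimensions, \<open>Z = T z\<close> is linear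
  (\<open>subspace_eq_by_local_dim\<close>), a contradiction.

  The differential geometry is done with polynomials only. The Hamiltonian vector fields of the
  functions in the ideal of \<open>Z\<close> are tangent to \<open>Z\<close>, and they span all tangent spaces
  (\<open>tangent_hvec\<close>), so identities between functions on \<open>Z\<close> can be differentiated along them.
\<close>

section \<open>Polynomial functions\<close>

definition monom_eval :: "('i \<Rightarrow>\<^sub>0 nat) \<Rightarrow> ('i \<Rightarrow> complex) \<Rightarrow> complex" where
  "monom_eval m v = (\<Prod>i\<in>Poly_Mapping.keys m. v i ^ Poly_Mapping.lookup m i)"

definition monom_degree :: "('i \<Rightarrow>\<^sub>0 nat) \<Rightarrow> nat" where
  "monom_degree m = (\<Sum>i\<in>Poly_Mapping.keys m. Poly_Mapping.lookup m i)"

lemma monom_eval_superset: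
  assumes "finite S" "Poly_Mapping.keys m \<subseteq> S"
  shows "monom_eval m v = (\<Prod>i\<in>S. v i ^ Poly_Mapping.lookup m i)"
  unfolding monom_eval_def using assms
  by (intro prod.mono_neutral_left) (auto simp: in_keys_iff)

lemma monom_degree_superset:
  assumes "finite S" "Poly_Mapping.keys m \<subseteq> S"
  shows "monom_degree m = (\<Sum>i\<in>S. Poly_Mapping.lookup m i)"
  unfolding monom_degree_def using assms
  by (intro sum.mono_neutral_left) (auto simp: in_keys_iff)

lemma monom_eval_add: "monom_eval (m + m') v = monom_eval m v * monom_eval m' v"
proof -
  let ?S = "Poly_Mapping.keys m \<union> Poly_Mapping.keys m'"
  have "Poly_Mapping.keys (m + m') \<subseteq> ?S" by (rule Poly_Mapping.keys_add)
  then show ?thesis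
    by (simp add: monom_eval_superset[of ?S] lookup_add power_add prod.distrib)
qed

lemma monom_degree_add: "monom_degree (m + m') = monom_degree m + monom_degree m'"
proof -
  let ?S = "Poly_Mapping.keys m \<union> Poly_Mapping.keys m'"
  have "Poly_Mapping.keys (m + m') \<subseteq> ?S" by (rule Poly_Mapping.keys_add)
  then show ?thesis
    by (simp add: monom_degree_superset[of ?S] lookup_add sum.distrib)
qed

lemma monom_eval_single [simp]: "monom_eval (Poly_Mapping.single i k) v = v i ^ k"
  by (cases "k = 0") (auto simp: monom_eval_def)

lemma monom_degree_single [simp]: "monom_degree (Poly_Mapping.single i k) = k"
  by (cases "k = 0") (auto simp: monom_degree_def)

lemma poly_eval_superset:
  assumes "finite S" "Poly_Mapping.keys p \<subseteq> S"
  shows "poly_eval p v = (\<Sum>m\<in>S. Poly_Mapping.lookup p m * monom_eval m v)"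
  unfolding poly_eval_def monom_eval_def[symmetric] using assms
  by (intro sum.mono_neutral_left) (auto simp: in_keys_iff)

lemma poly_eval_0 [simp]: "poly_eval 0 v = 0"
  by (simp add: poly_eval_def)

lemma poly_eval_add: "poly_eval (p + q) v = poly_eval p v + poly_eval q v"
proof -
  let ?S = "Poly_Mapping.keys p \<union> Poly_Mapping.keys q"
  have "Poly_Mapping.keys (p + q) \<subseteq> ?S" by (rule Poly_Mapping.keys_add)
  then show ?thesis
    by (simp add: poly_eval_superset[of ?S] lookup_add sum.distrib algebra_simps)
qed

lemma poly_eval_sum: "poly_eval (\<Sum>i\<in>A. f i) v = (\<Sum>i\<in>A. poly_eval (f i) v)"
  by (induction A rule: infinite_finite_induct) (auto simp: poly_eval_add)

lemma poly_eval_single [simp]: "poly_eval (Poly_Mapping.single m c) v = c * monom_eval m v"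
  by (cases "c = 0") (auto simp: poly_eval_def monom_eval_def)

lemma sum_monomials:
  "p = (\<Sum>m\<in>Poly_Mapping.keys p. Poly_Mapping.single m (Poly_Mapping.lookup p m))"
  by (rule poly_mapping_eqI)
     (auto simp: Poly_Mapping.lookup_sum lookup_single when_def sum.delta in_keys_iff)

lemma poly_eval_mult: "poly_eval (p * q) v = poly_eval p v * poly_eval q v"
proof -
  have "poly_eval (p * q) v =
      poly_eval ((\<Sum>m\<in>Poly_Mapping.keys p. Poly_Mapping.single m (Poly_Mapping.lookup p m)) *
        (\<Sum>m\<in>Poly_Mapping.keys q. Poly_Mapping.single m (Poly_Mapping.lookup q m))) v"
    by (simp flip: sum_monomials)
  also have "\<dots> = (\<Sum>m\<in>Poly_Mapping.keys p. Poly_Mapping.lookup p m * monom_eval m v) *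
      (\<Sum>m\<in>Poly_Mapping.keys q. Poly_Mapping.lookup q m * monom_eval m v)"
    by (simp add: sum_product poly_eval_sum mult_single monom_eval_add mult.assoc
        mult.left_commute)
  also have "\<dots> = poly_eval p v * poly_eval q v"
    by (simp add: poly_eval_def monom_eval_def)
  finally show ?thesis .
qed

text \<open>Polynomial functions are generated inductively because every analytic property that is needed
  below (derivatives, restriction to lines, substitution) follows by induction on the ring
  operations; only homogeneity has to look at monomials.\<close>

inductive polyfun :: "(complex^'m \<Rightarrow> complex) \<Rightarrow> bool" where
  const: "polyfun (\<lambda>_. c)"
| coord: "polyfun (\<lambda>x. x $ i)"
| add: "polyfun f \<Longrightarrow> polyfun g \<Longrightarrow> polyfun (\<lambda>x. f x + g x)"
| mult: "polyfun f \<Longrightarrow> polyfun g \<Longrightarrow> polyfun (\<lambda>x. f x * g x)"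

lemma polyfun_sum: "(\<And>i. i \<in> A \<Longrightarrow> polyfun (f i)) \<Longrightarrow> polyfun (\<lambda>x. \<Sum>i\<in>A. f i x)"
  by (induction A rule: infinite_finite_induct) (auto intro: polyfun.intros)

lemma polyfun_prod: "(\<And>i. i \<in> A \<Longrightarrow> polyfun (f i)) \<Longrightarrow> polyfun (\<lambda>x. \<Prod>i\<in>A. f i x)"
  by (induction A rule: infinite_finite_induct) (auto intro: polyfun.intros)

lemma polyfun_power: "polyfun f \<Longrightarrow> polyfun (\<lambda>x. f x ^ k)"
  by (induction k) (auto intro: polyfun.intros)

lemma polyfun_cmult: "polyfun f \<Longrightarrow> polyfun (\<lambda>x. c * f x)"
  by (intro polyfun.intros)

lemma polyfun_diff:
  assumes "polyfun f" "polyfun g" shows "polyfun (\<lambda>x. f x - g x)"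
  using polyfun.add[OF assms(1) polyfun_cmult[OF assms(2), of "-1"]] by simp

lemma polyfun_vec_eval: "polyfun (vec_eval p)"
  unfolding poly_eval_def by (intro polyfun_sum polyfun.mult polyfun.const polyfun_prod
      polyfun_power polyfun.coord)

lemma polyfun_iff: "polyfun f \<longleftrightarrow> (\<exists>p. f = vec_eval p)"
proof
  assume "polyfun f"
  then show "\<exists>p. f = vec_eval p"
  proof induction
    case (const c)
    show ?case by (rule exI[of _ "Poly_Mapping.single 0 c"]) (auto simp: monom_eval_def)
  next
    case (coord i)
    show ?case
      by (rule exI[of _ "Poly_Mapping.single (Poly_Mapping.single i 1) 1"]) auto
  next
    case (add f g)
    then obtain p q where "f = vec_eval p" "g = vec_eval q" by blast
    then show ?case by (intro exI[of _ "p + q"]) (auto simp: poly_eval_add)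
  next
    case (mult f g)
    then obtain p q where "f = vec_eval p" "g = vec_eval q" by blast
    then show ?case by (intro exI[of _ "p * q"]) (auto simp: poly_eval_mult)
  qed
qed (auto simp: polyfun_vec_eval)

lemma linear_formI:
  assumes "\<And>x y. f (x + y) = f x + f y" "\<And>c x. f (c *s x) = c * f x"
  shows "Vector_Spaces.linear (*s) (*) f"
  using assms vec.vector_space_axioms vector_space_over_itself.vector_space_axioms
  by (simp add: Vector_Spaces.linear_iff)

lemma linear_coordinates:
  assumes "Vector_Spaces.linear (*s) (*s) (g :: complex^'m \<Rightarrow> complex^'k)"
  shows "g x = (\<Sum>i\<in>UNIV. x $ i *s g (axis i 1))"
proof -
  interpret g: Vector_Spaces.linear "(*s)" "(*s)" g by fact
  have "g x = g (\<Sum>i\<in>UNIV. x $ i *s axis i 1)" by (simp add: basis_expansion)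
  then show ?thesis by (simp add: g.sum g.scale)
qed

lemma linear_form_coordinates:
  assumes "Vector_Spaces.linear (*s) (*) (g :: complex^'m \<Rightarrow> complex)"
  shows "g x = (\<Sum>i\<in>UNIV. x $ i * g (axis i 1))"
proof -
  interpret g: Vector_Spaces.linear "(*s)" "(*)" g by fact
  have "g x = g (\<Sum>i\<in>UNIV. x $ i *s axis i 1)" by (simp add: basis_expansion)
  then show ?thesis by (simp add: g.sum g.scale)
qed

lemma polyfun_linear_form:
  assumes "Vector_Spaces.linear (*s) (*) g" shows "polyfun g"
proof -
  have "g = (\<lambda>x. \<Sum>i\<in>UNIV. x $ i * g (axis i 1))"
    using linear_form_coordinates[OF assms] by blast
  moreover have "polyfun (\<lambda>x. \<Sum>i\<in>UNIV. x $ i * g (axis i 1))"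
    by (intro polyfun_sum polyfun.intros)
  ultimately show ?thesis by simp
qed

lemma polyfun_compose:
  assumes "polyfun f" "\<And>i. polyfun (\<lambda>x. g x $ i)"
  shows "polyfun (\<lambda>x. f (g x))"
  using assms(1) by induction (auto intro: polyfun.intros assms(2))

lemma polyfun_linear_coord:
  assumes "Vector_Spaces.linear (*s) (*s) (g :: complex^'m \<Rightarrow> complex^'k)"
  shows "polyfun (\<lambda>x. g x $ i)"
proof -
  have "(\<lambda>x. g x $ i) = (\<lambda>x. \<Sum>j\<in>UNIV. x $ j * g (axis j 1) $ i)"
    by (rule ext) (subst linear_coordinates[OF assms], simp)
  moreover have "polyfun (\<lambda>x. \<Sum>j\<in>UNIV. x $ j * g (axis j 1) $ i)"
    by (intro polyfun_sum polyfun.intros)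
  ultimately show ?thesis by simp
qed

lemma polyfun_compose_linear:
  "polyfun f \<Longrightarrow> Vector_Spaces.linear (*s) (*s) g \<Longrightarrow> polyfun (\<lambda>x. f (g x))"
  by (rule polyfun_compose) (auto intro: polyfun_linear_coord)

text \<open>This makes formal arguments exact: a polynomial function whose derivatives along a line all
  vanish at one point of the line vanishes on the whole line.\<close>

lemma polyfun_on_line: "polyfun f \<Longrightarrow> \<exists>P. \<forall>t. f (x + t *s u) = poly P t"
proof (induction rule: polyfun.induct)
  case (const c)
  show ?case by (rule exI[of _ "[:c:]"]) simp
next
  case (coord i)
  show ?case by (rule exI[of _ "[:x $ i, u $ i:]"]) (simp add: algebra_simps)
next
  case (add f g)
  then show ?case by (metis poly_add)
next
  case (mult f g)
  then show ?case by (metis poly_mult)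
qed

section \<open>Directional derivatives\<close>

definition dderiv :: "complex^'m \<Rightarrow> (complex^'m \<Rightarrow> complex) \<Rightarrow> complex^'m \<Rightarrow> complex" where
  "dderiv u f x = deriv (\<lambda>t. f (x + t *s u)) 0"

lemma bounded_linear_scale_vec: "bounded_linear (\<lambda>t::complex. t *s (u :: complex^'m))"
  unfolding linear_conv_bounded_linear[symmetric]
  by (rule linearI) (auto simp: vec_eq_iff algebra_simps)

lemma polyfun_has_derivative_aux:
  "polyfun f \<Longrightarrow> \<exists>f'. (f has_derivative f') (at x) \<and> (\<forall>c u. f' (c *s u) = c * f' u)"
proof (induction rule: polyfun.induct)
  case (const c)
  show ?case by (rule exI[of _ "\<lambda>_. 0"]) auto
next
  case (coord i)
  show ?case
    by (rule exI[of _ "\<lambda>u. u $ i"]) (auto intro!: bounded_linear_imp_has_derivative bounded_linear_vec_nth)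
next
  case (add f g)
  then obtain f' g' where "(f has_derivative f') (at x)" "\<forall>c u. f' (c *s u) = c * f' u"
    "(g has_derivative g') (at x)" "\<forall>c u. g' (c *s u) = c * g' u" by blast
  then show ?case
    by (intro exI[of _ "\<lambda>u. f' u + g' u"]) (auto intro!: derivative_intros simp: algebra_simps)
next
  case (mult f g)
  then obtain f' g' where "(f has_derivative f') (at x)" "\<forall>c u. f' (c *s u) = c * f' u"
    "(g has_derivative g') (at x)" "\<forall>c u. g' (c *s u) = c * g' u" by blast
  then show ?case
    by (intro exI[of _ "\<lambda>u. f x * g' u + f' u * g x"] conjI has_derivative_mult)
       (auto simp: algebra_simps)
qed

lemma line_has_derivative:
  assumes "(f has_derivative f') (at (x :: complex^'m))" "\<And>c u. f' (c *s u) = c * f' u"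
  shows "((\<lambda>t. f (x + t *s u)) has_field_derivative f' u) (at 0)"
proof -
  have "((\<lambda>t::complex. x + t *s u) has_derivative (\<lambda>t. t *s u)) (at 0)"
    by (auto intro!: derivative_eq_intros bounded_linear_imp_has_derivative bounded_linear_scale_vec)
  then have "((\<lambda>t. f (x + t *s u)) has_derivative (\<lambda>t. f' (t *s u))) (at 0)"
    by (rule has_derivative_compose) (use assms in simp)
  then show ?thesis
    by (simp add: has_field_derivative_def assms(2) mult.commute[of _ "f' u"] ext)
qed

lemma polyfun_has_derivative:
  assumes "polyfun f" shows "(f has_derivative (\<lambda>u. dderiv u f x)) (at x)"
proof -
  obtain f' where f': "(f has_derivative f') (at x)" "\<And>c u. f' (c *s u) = c * f' u"
    using polyfun_has_derivative_aux[OF assms] by blast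
  then have "dderiv u f x = f' u" for u
    unfolding dderiv_def by (intro DERIV_imp_deriv line_has_derivative)
  with f' show ?thesis by simp
qed

lemma dderiv_scale:
  assumes "polyfun f" shows "dderiv (c *s u) f x = c * dderiv u f x"
proof -
  obtain f' where f': "(f has_derivative f') (at x)" "\<And>c u. f' (c *s u) = c * f' u"
    using polyfun_has_derivative_aux[OF assms] by blast
  then have "dderiv u f x = f' u" for u
    unfolding dderiv_def by (intro DERIV_imp_deriv line_has_derivative)
  with f' show ?thesis by simp
qed

lemma dderiv_add_dir:
  assumes "polyfun f" shows "dderiv (u + v) f x = dderiv u f x + dderiv v f x"
  using has_derivative_linear[OF polyfun_has_derivative[OF assms]] by (rule linear_add)

lemma dderiv_linear: "polyfun f \<Longrightarrow> Vector_Spaces.linear (*s) (*) (\<lambda>u. dderiv u f x)"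
  by (rule linear_formI) (simp_all add: dderiv_scale dderiv_add_dir)

lemma polyfun_line_DERIV:
  assumes "polyfun f"
  shows "((\<lambda>t. f (x + t *s u)) has_field_derivative dderiv u f (x + t *s u)) (at t)"
proof -
  have "((\<lambda>h. f ((x + t *s u) + h *s u)) has_field_derivative dderiv u f (x + t *s u)) (at 0)"
    by (rule line_has_derivative[OF polyfun_has_derivative]) (auto simp: assms dderiv_scale)
  moreover have "(x + t *s u) + h *s u = x + (h + t) *s u" for h
    by (simp add: vec.scale_left_distrib)
  ultimately show ?thesis
    using DERIV_shift[of "\<lambda>t. f (x + t *s u)" _ 0 t] by simp
qed


lemma dderiv_eqI:
  "((\<lambda>t. f (x + t *s u)) has_field_derivative d) (at 0) \<Longrightarrow> dderiv u f x = d"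
  unfolding dderiv_def by (rule DERIV_imp_deriv)

lemma polyfun_line_DERIV_0:
  "polyfun f \<Longrightarrow> ((\<lambda>t. f (x + t *s u)) has_field_derivative dderiv u f x) (at 0)"
  using polyfun_line_DERIV[of f x u 0] by simp

lemma dderiv_const [simp]: "dderiv u (\<lambda>_. c) x = 0"
  by (rule dderiv_eqI) simp

lemma dderiv_coord [simp]: "dderiv u (\<lambda>x. x $ i) x = u $ i"
  by (rule dderiv_eqI) (auto intro!: derivative_eq_intros)

lemma dderiv_add:
  assumes "polyfun f" "polyfun g"
  shows "dderiv u (\<lambda>x. f x + g x) x = dderiv u f x + dderiv u g x"
  by (rule dderiv_eqI) (intro DERIV_add polyfun_line_DERIV_0 assms)

lemma dderiv_mult:
  assumes "polyfun f" "polyfun g"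
  shows "dderiv u (\<lambda>x. f x * g x) x = dderiv u f x * g x + f x * dderiv u g x"
  by (rule dderiv_eqI)
     (use DERIV_mult[OF polyfun_line_DERIV_0[OF assms(1), of x u] polyfun_line_DERIV_0[OF assms(2), of x u]]
      in \<open>simp add: mult.commute add.commute\<close>)

lemma dderiv_cmult: "polyfun f \<Longrightarrow> dderiv u (\<lambda>x. c * f x) x = c * dderiv u f x"
  by (simp add: dderiv_mult polyfun.const)

lemma dderiv_sum:
  "(\<And>i. i \<in> A \<Longrightarrow> polyfun (f i)) \<Longrightarrow> dderiv u (\<lambda>x. \<Sum>i\<in>A. f i x) x = (\<Sum>i\<in>A. dderiv u (f i) x)"
  by (induction A rule: infinite_finite_induct) (auto simp: dderiv_add polyfun_sum)

lemma polyfun_dderiv: "polyfun f \<Longrightarrow> polyfun (dderiv u f)"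
proof (induction rule: polyfun.induct)
  case (const c)
  have "dderiv u (\<lambda>_. c) = (\<lambda>_. 0)" by (rule ext) simp
  then show ?case by (simp add: polyfun.const)
next
  case (coord i)
  have "dderiv u (\<lambda>x. x $ i) = (\<lambda>_. u $ i)" by (rule ext) simp
  then show ?case by (simp add: polyfun.const)
next
  case (add f g)
  then have "dderiv u (\<lambda>x. f x + g x) = (\<lambda>x. dderiv u f x + dderiv u g x)"
    by (intro ext dderiv_add)
  with add show ?case by (simp add: polyfun.add)
next
  case (mult f g)
  then have "dderiv u (\<lambda>x. f x * g x) = (\<lambda>x. dderiv u f x * g x + f x * dderiv u g x)"
    by (intro ext dderiv_mult)
  with mult show ?case by (simp add: polyfun.intros)
qed

lemma dderiv_commute:
  "polyfun f \<Longrightarrow> dderiv u (dderiv v f) x = dderiv v (dderiv u f) x"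
proof (induction arbitrary: x rule: polyfun.induct)
  case (const c)
  have "dderiv u (\<lambda>_. c) = (\<lambda>_. 0)" for u :: "complex^'a" by (rule ext) simp
  then show ?case by simp
next
  case (coord i)
  have "dderiv u (\<lambda>x. x $ i) = (\<lambda>_. u $ i)" for u :: "complex^'a" by (rule ext) simp
  then show ?case by simp
next
  case (add f g)
  then have "dderiv u (\<lambda>x. f x + g x) = (\<lambda>x. dderiv u f x + dderiv u g x)" for u
    by (intro ext dderiv_add)
  with add show ?case by (simp add: dderiv_add polyfun_dderiv)
next
  case (mult f g)
  then have "dderiv u (\<lambda>x. f x * g x) = (\<lambda>x. dderiv u f x * g x + f x * dderiv u g x)" for u
    by (intro ext dderiv_mult)
  with mult show ?case
    by (simp add: dderiv_mult dderiv_add polyfun_dderiv polyfun.mult algebra_simps)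
qed

lemma dderiv_coordinates:
  assumes "polyfun f" shows "dderiv u f x = (\<Sum>i\<in>UNIV. u $ i * dderiv (axis i 1) f x)"
  by (rule linear_form_coordinates[OF dderiv_linear[OF assms]])

lemma polyfun_dderiv_field:
  assumes "polyfun f" "\<And>i. polyfun (\<lambda>x. \<xi> x $ i)"
  shows "polyfun (\<lambda>x. dderiv (\<xi> x) f x)"
  by (subst dderiv_coordinates[OF assms(1)]) (intro polyfun_sum polyfun.mult polyfun_dderiv assms)

lemma dderiv_dir_field:
  assumes "polyfun f" "\<And>i. polyfun (\<lambda>x. \<xi> x $ i)"
  shows "dderiv u (\<lambda>x. dderiv (\<xi> x) f x) x =
    dderiv u (dderiv (\<xi> x) f) x + dderiv (\<chi> i. dderiv u (\<lambda>x. \<xi> x $ i) x) f x"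
proof -
  have "dderiv u (\<lambda>x. dderiv (\<xi> x) f x) x
      = dderiv u (\<lambda>y. \<Sum>i\<in>UNIV. \<xi> y $ i * dderiv (axis i 1) f y) x"
    by (subst dderiv_coordinates[OF assms(1)]) simp
  also have "\<dots> = (\<Sum>i\<in>UNIV. dderiv u (\<lambda>y. \<xi> y $ i) x * dderiv (axis i 1) f x
      + \<xi> x $ i * dderiv u (dderiv (axis i 1) f) x)"
    by (simp add: dderiv_sum dderiv_mult assms polyfun.mult polyfun_dderiv)
  also have "(\<Sum>i\<in>UNIV. \<xi> x $ i * dderiv u (dderiv (axis i 1) f) x) = dderiv (\<xi> x) (dderiv u f) x"
    by (simp add: dderiv_coordinates[OF polyfun_dderiv[OF assms(1)], of "\<xi> x"]
        dderiv_commute[OF assms(1), of u])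
  then have "(\<Sum>i\<in>UNIV. dderiv u (\<lambda>y. \<xi> y $ i) x * dderiv (axis i 1) f x
      + \<xi> x $ i * dderiv u (dderiv (axis i 1) f) x) =
      (\<Sum>i\<in>UNIV. dderiv u (\<lambda>y. \<xi> y $ i) x * dderiv (axis i 1) f x) + dderiv (\<xi> x) (dderiv u f) x"
    by (simp add: sum.distrib)
  also have "(\<Sum>i\<in>UNIV. dderiv u (\<lambda>y. \<xi> y $ i) x * dderiv (axis i 1) f x)
      = dderiv (\<chi> i. dderiv u (\<lambda>x. \<xi> x $ i) x) f x"
    by (subst dderiv_coordinates[OF assms(1), of "\<chi> i. dderiv u (\<lambda>x. \<xi> x $ i) x"]) simp
  finally show ?thesis by (simp add: dderiv_commute[OF assms(1)])
qed

lemma dderiv_compose_linear: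
  assumes "polyfun f" "Vector_Spaces.linear (*s) (*s) g"
  shows "dderiv u (\<lambda>x. f (g x)) x = dderiv (g u) f (g x)"
proof (rule dderiv_eqI)
  interpret g: Vector_Spaces.linear "(*s)" "(*s)" g by fact
  show "((\<lambda>t. f (g (x + t *s u))) has_field_derivative dderiv (g u) f (g x)) (at 0)"
    using polyfun_line_DERIV_0[OF assms(1), of "g x" "g u"] by (simp add: g.add g.scale)
qed

lemma polyfun_continuous_on_line:
  assumes "polyfun f" shows "isCont (\<lambda>t. f (x + t *s u)) t"
  using polyfun_line_DERIV[OF assms] by (rule DERIV_isCont)

lemma polyfun_on_line_dderiv:
  assumes "polyfun f" "\<And>t. f (x + t *s u) = poly P t"
  shows "dderiv u f (x + t *s u) = poly (pderiv P) t"
  using DERIV_unique[OF polyfun_line_DERIV[OF assms(1), of x u t]] poly_DERIV[of P t] assms(2) by simp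

section \<open>Symplectic linear algebra\<close>

locale symplectic_space =
  fixes \<omega> :: "complex^'m \<Rightarrow> complex^'m \<Rightarrow> complex"
  assumes symplectic: "symplectic_form \<omega>"
begin

lemma linear_right: "Vector_Spaces.linear (*s) (*) (\<omega> u)"
  using symplectic by (simp add: symplectic_form_def)

lemma linear_left: "Vector_Spaces.linear (*s) (*) (\<lambda>u. \<omega> u v)"
  using symplectic by (simp add: symplectic_form_def)

lemma add_right: "\<omega> u (v + w) = \<omega> u v + \<omega> u w"
  and scale_right: "\<omega> u (c *s v) = c * \<omega> u v"
  using linear_right[of u] by (simp_all add: Vector_Spaces.linear_iff)

lemma add_left: "\<omega> (u + v) w = \<omega> u w + \<omega> v w"
  and scale_left: "\<omega> (c *s u) w = c * \<omega> u w"
  using linear_left[of w] by (simp_all add: Vector_Spaces.linear_iff)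

lemma zero_left [simp]: "\<omega> 0 v = 0" and zero_right [simp]: "\<omega> v 0 = 0"
  using scale_left[of 0 0 v] scale_right[of v 0 0] by auto

lemma diff_left: "\<omega> (u - v) w = \<omega> u w - \<omega> v w"
  using add_left[of "u - v" v w] by simp

lemma self [simp]: "\<omega> v v = 0"
  using symplectic by (simp add: symplectic_form_def)

lemma nondegenerate: "(\<And>v. \<omega> u v = 0) \<Longrightarrow> u = 0"
  using symplectic by (simp add: symplectic_form_def)

lemma antisym: "\<omega> u v = - \<omega> v u"
proof -
  have "0 = \<omega> (u + v) (u + v)" by simp
  also have "\<dots> = \<omega> u v + \<omega> v u" unfolding add_left add_right by simp
  finally show ?thesis by (simp add: eq_neg_iff_add_eq_0)
qed

lemma eqI: "(\<And>v. \<omega> u v = \<omega> u' v) \<Longrightarrow> u = u'"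
  using nondegenerate[of "u - u'"] by (simp add: diff_left)

lemma represent_functional:
  assumes "Vector_Spaces.linear (*s) (*) \<phi>"
  shows "\<exists>h. \<forall>v. \<omega> h v = \<phi> v"
proof -
  define \<Omega> where "\<Omega> u = (\<chi> i. \<omega> u (axis i 1))" for u
  have lin: "Vector_Spaces.linear (*s) (*s) \<Omega>"
    by (simp add: Vector_Spaces.linear_iff vec.vector_space_axioms \<Omega>_def vec_eq_iff add_left scale_left)
  have "inj \<Omega>"
  proof (rule injI)
    fix u v assume eq: "\<Omega> u = \<Omega> v"
    show "u = v"
    proof (rule eqI)
      fix w
      have "\<omega> u (axis i 1) = \<omega> v (axis i 1)" for i
        using eq by (simp add: \<Omega>_def vec_eq_iff)
      then show "\<omega> u w = \<omega> v w"
        by (simp add: linear_form_coordinates[OF linear_right, of _ w])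
    qed
  qed
  then have "surj \<Omega>" using lin by (intro vec.linear_inj_imp_surj)
  then obtain h where h: "\<Omega> h = (\<chi> i. \<phi> (axis i 1))" by (metis surjD)
  have "\<omega> h v = \<phi> v" for v
    using h by (simp add: linear_form_coordinates[OF linear_right, of _ v]
        linear_form_coordinates[OF assms, of v] \<Omega>_def vec_eq_iff)
  then show ?thesis by blast
qed

text \<open>A point outside a subspace is separated from it by a linear functional, and \<open>\<omega>\<close> represents that
  functional.\<close>

lemma double_perp:
  assumes "vec.subspace S" "\<And>y. (\<forall>s\<in>S. \<omega> y s = 0) \<Longrightarrow> \<omega> y x = 0"
  shows "x \<in> S"
proof (rule ccontr)
  assume x: "x \<notin> S"
  interpret vp: vector_space_pair "(*s) :: complex \<Rightarrow> complex^'m \<Rightarrow> complex^'m" "(*) :: complex \<Rightarrow> complex \<Rightarrow> complex" ..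
  obtain B where B: "B \<subseteq> S" "vec.independent B" "S \<subseteq> vec.span B" "card B = vec.dim S"
    using vec.basis_exists by blast
  have "vec.span B \<subseteq> S" using B(1) assms(1) by (rule vec.span_minimal)
  then have "vec.independent (insert x B)" "x \<notin> B"
    using B(1,2) x vec.independent_insertI by auto
  then obtain \<phi> where \<phi>: "Vector_Spaces.linear (*s) (*) \<phi>"
    "\<forall>y\<in>insert x B. \<phi> y = (if y = x then 1 else 0)"
    using vp.linear_independent_extend[of "insert x B" "\<lambda>y. if y = x then 1 else 0"] by blast
  obtain h where h: "\<And>v. \<omega> h v = \<phi> v" using represent_functional[OF \<phi>(1)] by blast
  have "vec.subspace {s. \<omega> h s = 0}"
    by (rule vec.subspaceI) (auto simp: add_right scale_right)
  moreover have "B \<subseteq> {s. \<omega> h s = 0}" using \<phi>(2) h \<open>x \<notin> B\<close> by auto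
  ultimately have "S \<subseteq> {s. \<omega> h s = 0}" using B(3) vec.span_minimal by blast
  then have "\<omega> h x = 0" using assms(2) by auto
  then show False using h \<phi>(2) by simp
qed

text \<open>If \<open>x\<close> is orthogonal to the isotropic space \<open>T\<close>, then \<open>T + \<complex> x\<close> is isotropic, so maximality puts
  \<open>x\<close> into \<open>T\<close>.\<close>

lemma lagrangian_iff_perp:
  assumes "lagrangian \<omega> T" shows "x \<in> T \<longleftrightarrow> (\<forall>t\<in>T. \<omega> x t = 0)"
proof
  assume "x \<in> T"
  with assms show "\<forall>t\<in>T. \<omega> x t = 0" by (auto simp: lagrangian_def isotropic_def)
next
  assume x: "\<forall>t\<in>T. \<omega> x t = 0"
  have sub: "vec.subspace T" and iso: "\<And>s t. s \<in> T \<Longrightarrow> t \<in> T \<Longrightarrow> \<omega> s t = 0"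
    using assms by (auto simp: lagrangian_def isotropic_def)
  have x': "\<omega> t x = 0" if "t \<in> T" for t using x antisym[of t x] that by simp
  let ?W = "vec.span (insert x T)"
  have W: "y \<in> ?W \<Longrightarrow> \<exists>t c. t \<in> T \<and> y = t + c *s x" for y
  proof -
    assume "y \<in> ?W"
    then obtain k where "y - k *s x \<in> T"
      using vec.span_breakdown_eq[of y x T] sub by (auto simp: vec.span_eq_iff[THEN iffD2])
    then show ?thesis by (intro exI[of _ "y - k *s x"] exI[of _ k]) simp
  qed
  have "isotropic \<omega> ?W" unfolding isotropic_def
  proof (intro conjI ballI)
    fix u v assume "u \<in> ?W" "v \<in> ?W"
    then obtain s c t d where "s \<in> T" "u = s + c *s x" "t \<in> T" "v = t + d *s x"
      using W by blast
    then show "\<omega> u v = 0" using x x' iso by (simp add: add_left add_right scale_left scale_right)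
  qed auto
  moreover have "T \<subseteq> ?W" by (meson subset_insertI vec.span_superset order_trans)
  ultimately have "?W = T" using assms by (auto simp: lagrangian_def)
  then show "x \<in> T" using vec.span_base[of x "insert x T"] by auto
qed

lemmas lagrangian_perpI = lagrangian_iff_perp[THEN iffD2, rule_format]
lemmas lagrangian_perpD = lagrangian_iff_perp[THEN iffD1, rule_format]

lemma lagrangian_eq:
  assumes "lagrangian \<omega> S" "lagrangian \<omega> T" "S \<subseteq> T" shows "S = T"
  using assms by (auto simp: lagrangian_def)

text \<open>The \<open>\<omega>\<close>-dual of the standard basis, from which the Hamiltonian vector of a function is built.\<close>

definition coord_vec :: "'m \<Rightarrow> complex^'m" where
  "coord_vec i = (SOME h. \<forall>v. \<omega> h v = v $ i)"

lemma omega_coord_vec: "\<omega> (coord_vec i) v = v $ i"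
proof -
  have "\<exists>h. \<forall>v. \<omega> h v = v $ i"
    by (rule represent_functional, rule linear_formI) auto
  then have "\<forall>v. \<omega> (coord_vec i) v = v $ i" unfolding coord_vec_def by (rule someI_ex)
  then show ?thesis by blast
qed

text \<open>The Hamiltonian vector field of \<open>f\<close>. It is written out in coordinates so that its components
  are visibly polynomial functions; \<open>omega_hvec\<close> is the usual characterisation.\<close>

definition hvec :: "(complex^'m \<Rightarrow> complex) \<Rightarrow> complex^'m \<Rightarrow> complex^'m" where
  "hvec f x = (\<Sum>i\<in>UNIV. dderiv (axis i 1) f x *s coord_vec i)"

lemma omega_hvec:
  assumes "polyfun f" shows "\<omega> (hvec f x) v = dderiv v f x"
proof -
  have "\<omega> (sum g A) v = (\<Sum>i\<in>A. \<omega> (g i) v)" for g :: "'m \<Rightarrow> _" and A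
    by (induction A rule: infinite_finite_induct) (auto simp: add_left)
  then show ?thesis
    by (simp add: hvec_def scale_left omega_coord_vec dderiv_coordinates[OF assms, of v] mult.commute)
qed

lemma hvec_eqI: "polyfun f \<Longrightarrow> (\<And>v. \<omega> h v = dderiv v f x) \<Longrightarrow> hvec f x = h"
  by (rule eqI) (simp add: omega_hvec)

text \<open>These linear operators \<open>F\<close> are the ones for which \<open>\<omega> (F u) v\<close> is again
  alternating in \<open>u\<close> and \<open>v\<close>.\<close>

definition self_adjoint :: "(complex^'m \<Rightarrow> complex^'m) \<Rightarrow> bool" where
  "self_adjoint F \<longleftrightarrow> Vector_Spaces.linear (*s) (*s) F \<and> (\<forall>u v. \<omega> (F u) v = \<omega> u (F v))"

lemma linear_hvec_coord:
  assumes "Vector_Spaces.linear (*s) (*s) F"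
  shows "F (hvec f x) $ i = (\<Sum>j\<in>UNIV. dderiv (axis j 1) f x * F (coord_vec j) $ i)"
proof -
  interpret F: Vector_Spaces.linear "(*s)" "(*s)" F by fact
  show ?thesis by (simp add: hvec_def F.sum F.scale)
qed

lemma polyfun_hvec:
  assumes "Vector_Spaces.linear (*s) (*s) F" "polyfun f"
  shows "polyfun (\<lambda>x. F (hvec f x) $ i)"
  unfolding linear_hvec_coord[OF assms(1)]
  by (intro polyfun_sum polyfun.mult polyfun_dderiv assms polyfun.const)

lemma dderiv_hvec:
  assumes "Vector_Spaces.linear (*s) (*s) F" "polyfun f"
  shows "dderiv u (\<lambda>x. F (hvec f x) $ i) x = F (hvec (dderiv u f) x) $ i"
  unfolding linear_hvec_coord[OF assms(1)]
  by (simp add: dderiv_sum dderiv_mult polyfun.intros polyfun_dderiv assms dderiv_commute[OF assms(2), of u])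

text \<open>The product rule for the generalised Poisson bracket \<open>{f, g}\<^sub>F = df (F H\<^sub>g)\<close>. Differentiating the
  Hamiltonian vector gives the Hamiltonian vector of the derivative, and self-adjointness of \<open>F\<close>
  turns that term into the mirror image of the first one.\<close>

lemma dderiv_hvec_field:
  assumes F: "self_adjoint F" and f: "polyfun f" and g: "polyfun g"
  shows "dderiv u (\<lambda>x. dderiv (F (hvec g x)) f x) x =
    dderiv u (dderiv (F (hvec g x)) f) x - dderiv u (dderiv (F (hvec f x)) g) x"
proof -
  have lin: "Vector_Spaces.linear (*s) (*s) F" and adj: "\<And>u v. \<omega> (F u) v = \<omega> u (F v)"
    using F by (auto simp: self_adjoint_def)
  have "dderiv (F (hvec (dderiv u g) x)) f x = \<omega> (F (hvec f x)) (hvec (dderiv u g) x)"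
    by (simp add: omega_hvec[OF f] adj)
  also have "\<dots> = - \<omega> (hvec (dderiv u g) x) (F (hvec f x))" by (rule antisym)
  also have "\<dots> = - dderiv u (dderiv (F (hvec f x)) g) x"
    by (simp add: omega_hvec polyfun_dderiv g dderiv_commute[OF g, of u])
  finally have "dderiv (F (hvec (dderiv u g) x)) f x = - dderiv u (dderiv (F (hvec f x)) g) x" .
  moreover have "(\<chi> i. dderiv u (\<lambda>x. F (hvec g x) $ i) x) = F (hvec (dderiv u g) x)"
    by (simp add: vec_eq_iff dderiv_hvec[OF lin g])
  ultimately show ?thesis
    by (simp add: dderiv_dir_field[OF f polyfun_hvec[OF lin g]])
qed

end

text \<open>Identities that are derived for all but finitely many values of a parameter are extended to the
  exceptional values by continuity.\<close>

lemma limit_point_eq: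
  fixes g h :: "complex \<Rightarrow> complex"
  assumes "isCont g a" "isCont h a" "finite S" "\<And>s. s \<noteq> a \<Longrightarrow> s \<notin> S \<Longrightarrow> g s = h s"
  shows "g a = h a"
proof -
  have "open (- (S - {a}))" by (intro open_Compl finite_imp_closed finite_Diff assms(3))
  then have "\<forall>\<^sub>F s in at a. s \<notin> S"
    unfolding eventually_at_topological by (intro exI[of _ "- (S - {a})"]) blast
  then have "\<forall>\<^sub>F s in at a. g s = h s"
    by (rule eventually_mp[rotated]) (auto simp: eventually_at_filter assms(4))
  then have "(g \<longlongrightarrow> h a) (at a)"
    using isContD[OF assms(2)] tendsto_cong by blast
  with isContD[OF assms(1)] show ?thesis by (rule tendsto_unique[rotated]) simp
qed

section \<open>Legendrian cones\<close>

definition ideal_of :: "(complex^'m) set \<Rightarrow> (complex^'m \<Rightarrow> complex) set" where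
  "ideal_of Z = {f. polyfun f \<and> (\<forall>x\<in>Z. f x = 0)}"

lemma tangent_space_iff:
  "w \<in> tangent_space Z x \<longleftrightarrow> (\<forall>f\<in>ideal_of Z. dderiv w f x = 0)"
proof -
  have "((\<lambda>t. f (x + t *s w)) has_field_derivative 0) (at 0) \<longleftrightarrow> dderiv w f x = 0" if "polyfun f" for f
    using polyfun_line_DERIV_0[OF that, of x w] dderiv_eqI by metis
  then show ?thesis
    unfolding tangent_space_def vanishing_ideal_def ideal_of_def
    by (auto simp: polyfun_iff)
qed

lemma dderiv_zero_dir [simp]: "dderiv 0 f x = 0"
  by (rule dderiv_eqI) simp

lemma subspace_tangent_space: "vec.subspace (tangent_space Z x)"
  by (rule vec.subspaceI)
     (auto simp: tangent_space_iff ideal_of_def dderiv_add_dir dderiv_scale)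

text \<open>Uniqueness of the flow of the vector field \<open>(1 + c t) d/dt\<close>, which does not vanish at \<open>0\<close>, in
  algebraic form. The \<open>k\<close>-th coefficient of \<open>(1 + c t) P'\<close> combines the coefficients of \<open>P\<close> of orders
  \<open>k + 1\<close> and \<open>k\<close>, so the coefficients of all members of the family vanish order by order.\<close>

lemma stable_polys_zero:
  assumes "\<And>P. P \<in> \<P> \<Longrightarrow> poly P 0 = 0"
    and "\<And>P. P \<in> \<P> \<Longrightarrow> [:1, c:] * pderiv P \<in> \<P>" and "P \<in> \<P>"
  shows "P = (0 :: complex poly)"
proof (rule poly_eqI)
  fix k show "coeff P k = coeff 0 k"
    using assms(3)
  proof (induction k arbitrary: P)
    case 0
    then show ?case using assms(1)[OF 0] by (simp add: poly_0_coeff_0)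
  next
    case (Suc k)
    have "coeff ([:1, c:] * pderiv P) k = 0"
      using Suc.IH[OF assms(2)[OF Suc.prems]] by simp
    moreover have "coeff P k = 0" using Suc by simp
    then have "coeff (monom 1 1 * pderiv P) k = 0"
      by (cases k) (auto simp: coeff_pderiv coeff_monom_mult)
    moreover have "[:1, c:] * pderiv P = pderiv P + smult c (monom 1 1 * pderiv P)"
      by (simp add: monom_altdef)
    ultimately have "coeff (pderiv P) k = 0" by simp
    then have "of_nat (Suc k) * coeff P (Suc k) = 0" by (simp only: coeff_pderiv)
    then show ?case unfolding mult_eq_0_iff of_nat_eq_0_iff by simp
  qed
qed

text \<open>The affine cone \<open>Z\<close> of a smooth Legendrian variety, with the properties that the infinitesimal
  arguments use. Smoothness is present only through the tangent spaces: the Zariski tangent spaces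
  away from the vertex are all Lagrangian and therefore have the same dimension.\<close>

locale legendrian_cone = symplectic_space \<omega>
  for \<omega> :: "complex^'m \<Rightarrow> complex^'m \<Rightarrow> complex" +
  fixes Z :: "(complex^'m) set"
  assumes cone: "x \<in> Z \<Longrightarrow> c *s x \<in> Z"
    and nontrivial: "\<exists>x\<in>Z. x \<noteq> 0"
    and closed: "(\<And>f. f \<in> ideal_of Z \<Longrightarrow> f x = 0) \<Longrightarrow> x \<in> Z"
    and lagrangian_tangent: "x \<in> Z \<Longrightarrow> x \<noteq> 0 \<Longrightarrow> lagrangian \<omega> (tangent_space Z x)"
begin

abbreviation I where "I \<equiv> ideal_of Z"
abbreviation T where "T x \<equiv> tangent_space Z x"

lemma I_polyfun: "f \<in> I \<Longrightarrow> polyfun f" and I_zero: "f \<in> I \<Longrightarrow> x \<in> Z \<Longrightarrow> f x = 0"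
  by (auto simp: ideal_of_def)

lemma T_zero: "u \<in> T x \<Longrightarrow> f \<in> I \<Longrightarrow> dderiv u f x = 0"
  by (auto simp: tangent_space_iff)

lemma zero_in_Z: "0 \<in> Z"
proof -
  obtain x where "x \<in> Z" using nontrivial by blast
  from cone[OF this, of 0] show ?thesis by simp
qed

text \<open>The tangent space at the vertex is not controlled; but a polynomial function that vanishes on
  the punctured cone vanishes at the vertex too, by continuity along a ruling.\<close>

lemma I_from_nonzero:
  assumes f: "polyfun f" and "\<And>x. x \<in> Z \<Longrightarrow> x \<noteq> 0 \<Longrightarrow> f x = 0"
  shows "f \<in> I"
proof -
  obtain x where x: "x \<in> Z" "x \<noteq> 0" using nontrivial by blast
  have "f (0 + 0 *s x) = 0"
    by (rule limit_point_eq[where g = "\<lambda>t. f (0 + t *s x)" and h = "\<lambda>_. 0" and S = "{}"])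
       (use x polyfun_continuous_on_line[OF f, where x = 0 and u = x] in \<open>auto intro: assms(2) cone\<close>)
  then have "f 0 = 0" by simp
  then show ?thesis using assms by (auto simp: ideal_of_def)
qed

lemma hvec_tangent:
  assumes "f \<in> I" "x \<in> Z" "x \<noteq> 0" shows "hvec f x \<in> T x"
  by (rule lagrangian_perpI[OF lagrangian_tangent[OF assms(2,3)]])
     (simp add: omega_hvec I_polyfun assms(1) T_zero)

text \<open>The Hamiltonian vectors of the ideal at \<open>x\<close> form a subspace whose orthogonal complement is, by
  definition, the tangent space \<open>T x\<close>; so they form \<open>(T x)\<^sup>\<bottom> = T x\<close>. This supplies enough polynomial
  vector fields tangent to \<open>Z\<close>: they span every tangent space away from the vertex.\<close>

lemma tangent_hvec:
  assumes "x \<in> Z" "x \<noteq> 0" "u \<in> T x" obtains f where "f \<in> I" "hvec f x = u"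
proof -
  let ?S = "(\<lambda>f. hvec f x) ` I"
  have "vec.subspace ?S"
  proof (rule vec.subspaceI)
    have "hvec (\<lambda>_. 0) x = 0" by (simp add: hvec_def)
    moreover have "(\<lambda>_. 0) \<in> I" by (auto simp: ideal_of_def polyfun.const)
    ultimately show "0 \<in> ?S" by (intro image_eqI[where x = "\<lambda>_. 0"]) auto
  next
    fix u v assume "u \<in> ?S" "v \<in> ?S"
    then obtain f g where "f \<in> I" "u = hvec f x" "g \<in> I" "v = hvec g x" by blast
    moreover from this have "(\<lambda>x. f x + g x) \<in> I" "hvec (\<lambda>x. f x + g x) x = u + v"
      by (auto simp: ideal_of_def polyfun.add dderiv_add hvec_def sum.distrib vec.scale_left_distrib)
    ultimately show "u + v \<in> ?S" by (intro image_eqI[where x = "\<lambda>x. f x + g x"]) auto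
  next
    fix c u assume "u \<in> ?S"
    then obtain f where "f \<in> I" "u = hvec f x" by blast
    moreover from this have "(\<lambda>x. c * f x) \<in> I" "hvec (\<lambda>x. c * f x) x = c *s u"
      by (auto simp: ideal_of_def polyfun_cmult dderiv_cmult hvec_def vec.scale_sum_right)
    ultimately show "c *s u \<in> ?S" by (intro image_eqI[where x = "\<lambda>x. c * f x"]) auto
  qed
  then have "u \<in> ?S"
  proof (rule double_perp)
    fix y assume "\<forall>s\<in>?S. \<omega> y s = 0"
    then have "\<omega> (hvec f x) y = 0" if "f \<in> I" for f
      using antisym[of "hvec f x" y] that by auto
    then have "y \<in> T x" by (simp add: tangent_space_iff omega_hvec I_polyfun)
    then show "\<omega> y u = 0"
      using lagrangian_perpD[OF lagrangian_tangent[OF assms(1,2)] _ assms(3)] by blast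
  qed
  then show ?thesis using that by blast
qed

lemma radial_tangent: "x \<in> Z \<Longrightarrow> x \<in> T x"
proof -
  assume x: "x \<in> Z"
  have "dderiv x f x = 0" if "f \<in> I" for f
  proof (rule dderiv_eqI)
    have "f (x + t *s x) = 0" for t
      using I_zero[OF that cone[OF x, of "1 + t"]] by (simp add: vec.scale_left_distrib)
    then show "((\<lambda>t. f (x + t *s x)) has_field_derivative 0) (at 0)" by simp
  qed
  then show ?thesis by (simp add: tangent_space_iff)
qed

text \<open>The line \<open>x + t v\<close> is an integral curve, with rescaled time, of the vector field \<open>F\<close>, which is
  tangent to \<open>Z\<close>. So the derivation along \<open>F\<close> preserves the ideal, and the restrictions to the line
  of the functions in the ideal form a family to which \<open>stable_polys_zero\<close> applies.\<close>

lemma flow: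
  assumes x: "x \<in> Z" and F: "\<And>y i. polyfun (\<lambda>y. F y $ i)"
    and tan: "\<And>y. y \<in> Z \<Longrightarrow> y \<noteq> 0 \<Longrightarrow> F y \<in> T y"
    and speed: "\<And>t. F (x + t *s v) = (1 + c * t) *s v"
  shows "x + t *s v \<in> Z"
proof (rule closed)
  fix f assume f: "f \<in> I"
  let ?\<P> = "{P. \<exists>f\<in>I. \<forall>t. f (x + t *s v) = poly P t}"
  obtain P where P: "\<forall>t. f (x + t *s v) = poly P t"
    using polyfun_on_line[OF I_polyfun[OF f]] by blast
  have "P = 0"
  proof (rule stable_polys_zero[of ?\<P>])
    fix P assume "P \<in> ?\<P>"
    then obtain f where f: "f \<in> I" and P: "\<And>t. f (x + t *s v) = poly P t" by blast
    show "poly P 0 = 0" using P[of 0] I_zero[OF f x] by simp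
    have "(\<lambda>y. dderiv (F y) f y) \<in> I"
      by (rule I_from_nonzero) (simp_all add: polyfun_dderiv_field I_polyfun[OF f] F T_zero[OF tan f])
    moreover have "dderiv (F (x + t *s v)) f (x + t *s v) = poly ([:1, c:] * pderiv P) t" for t
      unfolding speed dderiv_scale[OF I_polyfun[OF f]]
      using polyfun_on_line_dderiv[OF I_polyfun[OF f] P, of t]
      by (simp add: algebra_simps)
    ultimately show "[:1, c:] * pderiv P \<in> ?\<P>"
      by (intro CollectI bexI[of _ "\<lambda>y. dderiv (F y) f y"]) auto
  qed (use f P in blast)
  then show "f (x + t *s v) = 0" using P by simp
qed

text \<open>The linear form \<open>\<omega> h\<close> lies in the ideal, so \<open>h\<close> is orthogonal to every tangent space and hence
  contained in all of them: the constant vector field \<open>h\<close> is tangent to \<open>Z\<close>.\<close>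

lemma degenerate_vertex:
  assumes h: "\<And>x. x \<in> Z \<Longrightarrow> \<omega> h x = 0" and x: "x \<in> Z"
  shows "x + t *s h \<in> Z"
proof (rule flow[where F = "\<lambda>_. h" and c = 0])
  fix y assume y: "y \<in> Z" "y \<noteq> 0"
  have "\<omega> h \<in> I" using h by (auto simp: ideal_of_def intro: polyfun_linear_form linear_right)
  then have "dderiv u (\<omega> h) y = 0" if "u \<in> T y" for u using T_zero that by blast
  moreover have "dderiv u (\<omega> h) y = \<omega> h u" for u
    by (rule dderiv_eqI) (auto simp: add_right scale_right intro!: derivative_eq_intros)
  ultimately show "h \<in> T y"
    by (intro lagrangian_perpI[OF lagrangian_tangent[OF y]]) simp
qed (auto simp: x polyfun.const)

text \<open>Since \<open>Z\<close> is a cone with vertex \<open>h\<close>, it lies in the tangent space at \<open>h\<close>. Hence all vectors of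
  the Lagrangian space \<open>T h\<close> are orthogonal to \<open>Z\<close>; so they are vertices as well and lie in
  \<open>Z\<close>.\<close>

lemma degenerate_linear:
  assumes h: "\<And>x. x \<in> Z \<Longrightarrow> \<omega> h x = 0" and "h \<noteq> 0"
  shows "vec.subspace Z"
proof -
  have hZ: "h \<in> Z" using degenerate_vertex[OF h zero_in_Z, of 1] by simp
  have "Z \<subseteq> T h"
  proof
    fix x assume x: "x \<in> Z"
    have "dderiv x f h = 0" if "f \<in> I" for f
    proof (rule dderiv_eqI)
      have "h + t *s x \<in> Z" for t
        using degenerate_vertex[OF h cone[OF x], of t 1] by (simp add: add.commute)
      then have "f (h + t *s x) = 0" for t using I_zero[OF that] by blast
      then show "((\<lambda>t. f (h + t *s x)) has_field_derivative 0) (at 0)" by simp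
    qed
    then show "x \<in> T h" by (simp add: tangent_space_iff)
  qed
  moreover have "T h \<subseteq> Z"
  proof
    fix y assume y: "y \<in> T h"
    have "\<omega> y x = 0" if "x \<in> Z" for x
      using that \<open>Z \<subseteq> T h\<close> by (intro lagrangian_perpD[OF lagrangian_tangent[OF hZ \<open>h \<noteq> 0\<close>] y]) auto
    from degenerate_vertex[OF this zero_in_Z, of 1] show "y \<in> Z" by simp
  qed
  ultimately show ?thesis using subspace_tangent_space[of Z h] by (simp add: subset_antisym)
qed

end

section \<open>Symmetric operators tangent to the cone\<close>

lemma (in symplectic_space) hvec_compose:
  assumes g: "self_adjoint g" and f: "polyfun f"
  shows "hvec (\<lambda>x. f (g x)) z = g (hvec f (g z))"
proof -
  have lin: "Vector_Spaces.linear (*s) (*s) g" and adj: "\<And>u v. \<omega> (g u) v = \<omega> u (g v)"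
    using g by (auto simp: self_adjoint_def)
  show ?thesis
    by (rule hvec_eqI) (simp_all add: polyfun_compose_linear f lin dderiv_compose_linear adj omega_hvec)
qed

lemma dderiv2_compose_linear:
  assumes "polyfun f" "Vector_Spaces.linear (*s) (*s) g"
  shows "dderiv u (dderiv v (\<lambda>x. f (g x))) z = dderiv (g u) (dderiv (g v) f) (g z)"
proof -
  have "dderiv v (\<lambda>x. f (g x)) = (\<lambda>x. dderiv (g v) f (g x))"
    by (rule ext) (rule dderiv_compose_linear[OF assms])
  then show ?thesis by (simp add: dderiv_compose_linear polyfun_dderiv assms)
qed

context legendrian_cone
begin

text \<open>These operators correspond to the alternating forms for which all tangent spaces of \<open>Z\<close> are
  isotropic; \<open>F\<close> corresponds to the form \<open>\<omega> (F u) v\<close>.\<close>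

definition compatible :: "(complex^'m \<Rightarrow> complex^'m) \<Rightarrow> bool" where
  "compatible F \<longleftrightarrow> self_adjoint F \<and> (\<forall>x\<in>Z. x \<noteq> 0 \<longrightarrow> (\<forall>u\<in>T x. F u \<in> T x))"

lemma compatible_linear: "compatible F \<Longrightarrow> Vector_Spaces.linear (*s) (*s) F"
  and compatible_adj: "compatible F \<Longrightarrow> \<omega> (F u) v = \<omega> u (F v)"
  and compatible_T: "compatible F \<Longrightarrow> x \<in> Z \<Longrightarrow> x \<noteq> 0 \<Longrightarrow> u \<in> T x \<Longrightarrow> F u \<in> T x"
  by (auto simp: compatible_def self_adjoint_def)

lemma compatible_shift:
  assumes "compatible F" shows "compatible (\<lambda>x. F x + s *s x)"
  using assms subspace_tangent_space[of Z]
  by (auto simp: compatible_def self_adjoint_def Vector_Spaces.linear_iff add_left add_right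
      scale_left scale_right algebra_simps vec.scale_right_distrib
      intro!: vec.subspace_add vec.subspace_scale)

lemma compatible_id: "compatible (\<lambda>x. x)"
  by (auto simp: compatible_def self_adjoint_def Vector_Spaces.linear_iff vec.vector_space_axioms)

text \<open>The identity \<open>dp (F H\<^sub>r) = 0\<close> holds on \<open>Z\<close> because \<open>F H\<^sub>r\<close> is tangent; this is its derivative in the
  tangent direction \<open>u\<close>. For \<open>F = id\<close> it says that the second derivative of \<open>p\<close> on \<open>T z\<close> depends on
  \<open>p\<close> only through \<open>H\<^sub>p z\<close>, and that it is a symmetric cubic form on \<open>T z\<close>: the second fundamental
  form of \<open>Z\<close>. For general \<open>F\<close> it says that \<open>F\<close> can be moved between the arguments of that form.\<close>

lemma hessian_exchange:
  assumes F: "compatible F" and z: "z \<in> Z" "z \<noteq> 0" and u: "u \<in> T z" and p: "p \<in> I" and r: "r \<in> I"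
  shows "dderiv u (dderiv (F (hvec r z)) p) z = dderiv u (dderiv (F (hvec p z)) r) z"
proof -
  have "(\<lambda>x. dderiv (F (hvec r x)) p x) \<in> I"
    by (rule I_from_nonzero)
       (simp_all add: polyfun_dderiv_field I_polyfun p r polyfun_hvec compatible_linear F
         T_zero[OF compatible_T[OF F _ _ hvec_tangent]])
  then have "dderiv u (\<lambda>x. dderiv (F (hvec r x)) p x) z = 0" using T_zero u by blast
  then show ?thesis
    using dderiv_hvec_field[of F p r u z] F p r by (simp add: compatible_def I_polyfun)
qed

lemma hessian_exchange_id:
  assumes "z \<in> Z" "z \<noteq> 0" "u \<in> T z" "p \<in> I" "r \<in> I"
  shows "dderiv u (dderiv (hvec r z) p) z = dderiv u (dderiv (hvec p z) r) z"
  using hessian_exchange[OF compatible_id assms] .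

end

text \<open>\<open>E\<close> is a multiple of a projection if \<open>c \<noteq> 0\<close>, and it has square zero if \<open>c = 0\<close>.\<close>

locale quadratic_operator = legendrian_cone \<omega> Z
  for \<omega> :: "complex^'m \<Rightarrow> complex^'m \<Rightarrow> complex" and Z :: "(complex^'m) set" +
  fixes E :: "complex^'m \<Rightarrow> complex^'m" and c :: complex
  assumes compat: "compatible E" and square: "E (E x) = c *s E x"
begin

text \<open>For \<open>s \<noteq> 0, - c\<close> the operator \<open>s + E\<close> is invertible; up to scalars, these operators are the
  elements \<open>exp (t E)\<close> of the flow of the vector field \<open>E\<close>. As \<open>s\<close> tends to \<open>0\<close>, the point \<open>s z + E z\<close> degenerates to \<open>E z\<close>, and all of the
  geometry below comes from this limit.\<close>

definition orb :: "complex \<Rightarrow> complex^'m \<Rightarrow> complex^'m" where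
  "orb s x = E x + s *s x"

lemma E_add: "E (x + y) = E x + E y" and E_scale: "E (k *s x) = k *s E x"
  using compatible_linear[OF compat] by (auto simp: Vector_Spaces.linear_iff)

lemma compatible_orb: "compatible (orb s)"
  using compatible_shift[OF compat, of s] by (simp add: orb_def[abs_def])

lemma E_orb: "E (orb s x) = (c + s) *s E x"
  by (simp add: orb_def E_add E_scale square vec.scale_left_distrib)

lemma orb_inverse:
  "s \<noteq> 0 \<Longrightarrow> s \<noteq> - c \<Longrightarrow> orb s ((1 / (s * (s + c))) *s ((s + c) *s x - E x)) = x"
proof -
  assume s: "s \<noteq> 0" "s \<noteq> - c"
  have [simp]: "E (x - y) = E x - E y" for x y
    using E_add[of "x - y" y] by simp
  have "s + c \<noteq> 0" using s by (simp add: add_eq_0_iff2)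
  have "orb s ((s + c) *s x - E x) = (s * (s + c)) *s x"
    by (simp add: orb_def E_add E_scale square vec_eq_iff algebra_simps)
  moreover have "orb s (k *s y) = k *s orb s y" for k y
    by (simp add: orb_def E_scale vec_eq_iff algebra_simps)
  ultimately have "orb s ((1 / (s * (s + c))) *s ((s + c) *s x - E x)) =
      (1 / (s * (s + c))) *s ((s * (s + c)) *s x)" by (simp only:)
  then show ?thesis by (simp only: vec.scale_scale) (simp add: s \<open>s + c \<noteq> 0\<close>)
qed

lemma orb_nonzero: "s \<noteq> 0 \<Longrightarrow> s \<noteq> - c \<Longrightarrow> x \<noteq> 0 \<Longrightarrow> orb s x \<noteq> 0"
proof
  assume s: "s \<noteq> 0" "s \<noteq> - c" "x \<noteq> 0" "orb s x = 0"
  then have "E x = (- s) *s x" by (simp add: orb_def eq_neg_iff_add_eq_0)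
  then have "c *s ((- s) *s x) = (- s) *s ((- s) *s x)"
    using square[of x] by (metis E_scale)
  moreover have "(s * (s + c)) *s x = (- s) *s ((- s) *s x) - c *s ((- s) *s x)"
    by (simp add: algebra_simps vec_eq_iff)
  ultimately have "(s * (s + c)) *s x = 0" by simp
  moreover have "s + c \<noteq> 0" using s by (simp add: add_eq_0_iff2)
  ultimately show False using s by simp
qed

lemma orb_in_Z:
  assumes z: "z \<in> Z" shows "orb s z \<in> Z"
proof -
  have *: "orb s z \<in> Z" if "s \<noteq> 0" for s
  proof -
    have "z + (1 / s) *s E z \<in> Z"
    proof (rule flow[OF z, where F = E and c = c])
      show "E (z + t *s E z) = (1 + c * t) *s E z" for t
        by (simp add: E_add E_scale square vec_eq_iff algebra_simps)
    qed (simp_all add: polyfun_linear_coord compatible_linear compat radial_tangent compatible_T)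
    from cone[OF this, of s] show ?thesis
      using that by (simp add: orb_def vec_eq_iff algebra_simps)
  qed
  show ?thesis
  proof (cases "s = 0")
    case True
    have "E z \<in> Z"
    proof (rule closed)
      fix f assume f: "f \<in> I"
      have "f (E z + 0 *s z) = 0"
        by (rule limit_point_eq[where g = "\<lambda>t. f (E z + t *s z)" and h = "\<lambda>_. 0" and S = "{}"])
           (use *[unfolded orb_def] f in \<open>simp_all add: polyfun_continuous_on_line I_polyfun I_zero\<close>)
      then show "f (E z) = 0" by simp
    qed
    then show ?thesis using True by (simp add: orb_def)
  qed (use * in auto)
qed

text \<open>The invertible operators \<open>s + E\<close> map \<open>Z\<close> to itself and preserve \<open>T z\<close>. At the exceptional values
  of \<open>s\<close> the claim follows by continuity, since the tangent space there is Lagrangian as well: this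
  is where smoothness at the limit point enters.\<close>

lemma tangent_orb:
  assumes z: "z \<in> Z" "z \<noteq> 0" "orb s z \<noteq> 0" shows "T (orb s z) = T z"
proof -
  have lin: "Vector_Spaces.linear (*s) (*s) (orb s)" for s by (rule compatible_linear[OF compatible_orb])
  have *: "dderiv u f (orb s z) = 0" if s: "s \<noteq> 0" "s \<noteq> - c" and u: "u \<in> T z" and f: "f \<in> I" for s u f
  proof -
    let ?u = "(1 / (s * (s + c))) *s ((s + c) *s u - E u)"
    have "?u \<in> T z"
      by (intro vec.subspace_scale vec.subspace_diff subspace_tangent_space compatible_T[OF compat] u z)
    moreover have "(\<lambda>x. f (orb s x)) \<in> I"
      using f by (auto simp: ideal_of_def polyfun_compose_linear lin orb_in_Z)
    ultimately have "dderiv ?u (\<lambda>x. f (orb s x)) z = 0" using T_zero by blast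
    then show ?thesis
      by (simp only: dderiv_compose_linear[OF I_polyfun[OF f] lin] orb_inverse[OF s])
  qed
  have "T z \<subseteq> T (orb s z)"
  proof
    fix u assume u: "u \<in> T z"
    have "dderiv u f (E z + s *s z) = 0" if f: "f \<in> I" for f
      by (rule limit_point_eq[where g = "\<lambda>t. dderiv u f (E z + t *s z)" and h = "\<lambda>_. 0" and S = "{0, - c}"])
         (use * f u in \<open>auto intro!: polyfun_continuous_on_line I_polyfun polyfun_dderiv simp: orb_def\<close>)
    then show "u \<in> T (orb s z)" by (simp add: tangent_space_iff orb_def)
  qed
  then show ?thesis
    using lagrangian_eq[OF lagrangian_tangent[OF z(1,2)] lagrangian_tangent[OF orb_in_Z[OF z(1)] z(3)]]
    by simp
qed

text \<open>The second fundamental forms at \<open>z\<close> and at \<open>g z\<close>, where \<open>g = s + E\<close>, live on the same space \<open>T z\<close>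
  and are compared by pulling back functions along \<open>g\<close>: if \<open>C\<close> denotes the cubic form, then
  \<open>C\<^sub>z (u, v, g k) = C (g u, g v, k)\<close> with the right-hand side taken at \<open>g z\<close>. There \<open>g\<close> can be moved
  from \<open>v\<close> to \<open>k\<close>, and with \<open>h = g k\<close> this becomes \<open>C\<^sub>z (u, v, h) = C (g u, v, h)\<close>.\<close>

lemma hessian_orb:
  assumes z: "z \<in> Z" "z \<noteq> 0" and s: "s \<noteq> 0" "s \<noteq> - c" and u: "u \<in> T z"
    and p: "p \<in> I" and r: "r \<in> I"
  shows "dderiv u (dderiv (hvec p (orb s z)) r) z =
    dderiv (orb s u) (dderiv (hvec r z) p) (orb s z)"
proof -
  let ?g = "orb s" and ?y = "orb s z" and ?v = "hvec r z" and ?h = "hvec p (orb s z)"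
  have lin: "Vector_Spaces.linear (*s) (*s) ?g" by (rule compatible_linear[OF compatible_orb])
  have y: "?y \<in> Z" "?y \<noteq> 0" using orb_in_Z orb_nonzero z s by auto
  have Ty: "T ?y = T z" using tangent_orb z y by simp
  have u': "?g u \<in> T ?y" using compatible_T[OF compatible_orb z u] Ty by simp
  have "(1 / (s * (s + c))) *s ((s + c) *s ?h - E ?h) \<in> T ?y"
    by (intro vec.subspace_scale vec.subspace_diff subspace_tangent_space compatible_T[OF compat] y
        hvec_tangent p)
  then obtain q where q: "q \<in> I" "hvec q ?y = (1 / (s * (s + c))) *s ((s + c) *s ?h - E ?h)"
    using tangent_hvec[OF y] by blast
  have gq: "?g (hvec q ?y) = ?h" using orb_inverse[OF s, of ?h] q(2) by simp
  obtain r' where r': "r' \<in> I" "hvec r' ?y = ?v"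
    using tangent_hvec[OF y] hvec_tangent[OF r z] Ty by blast
  let ?q = "\<lambda>x. q (?g x)"
  have qI: "?q \<in> I" using q(1) by (auto simp: ideal_of_def polyfun_compose_linear lin orb_in_Z)
  have hq: "hvec ?q z = ?h"
    using hvec_compose[of ?g q z] compatible_orb q(1) gq by (simp add: compatible_def I_polyfun)
  have "dderiv u (dderiv ?h r) z = dderiv u (dderiv ?v ?q) z"
    using hessian_exchange_id[OF z u qI r] hq by simp
  also have "\<dots> = dderiv (?g u) (dderiv (?g ?v) q) ?y"
    by (rule dderiv2_compose_linear[OF I_polyfun[OF q(1)] lin])
  also have "\<dots> = dderiv (?g u) (dderiv ?h r') ?y"
    using hessian_exchange[OF compatible_orb y u' q(1) r'(1), of s] r'(2) gq by simp
  also have "\<dots> = dderiv (?g u) (dderiv ?v p) ?y"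
    using hessian_exchange_id[OF y u' p r'(1)] r'(2) by simp
  finally show ?thesis .
qed

text \<open>Under the hypothesis on \<open>E u\<close>, the preceding comparison says that on \<open>u\<close> and \<open>v\<close> the second
  fundamental form at \<open>z\<close> is \<open>s\<close> times the one at \<open>s z + E z\<close>. As \<open>s\<close> tends to \<open>0\<close> the latter stays finite, because the
  limit point \<open>E z\<close> is a smooth point of \<open>Z\<close>; so the former is zero.\<close>

lemma hessian_limit:
  assumes z: "z \<in> Z" "E z \<noteq> 0" and u: "u \<in> T z" and v: "v \<in> T z"
    and orth: "\<And>s p. s \<noteq> 0 \<Longrightarrow> s \<noteq> - c \<Longrightarrow> p \<in> I \<Longrightarrow> dderiv (E u) (dderiv v p) (orb s z) = 0"
    and q: "q \<in> I"
  shows "dderiv u (dderiv v q) z = 0"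
proof -
  have z0: "z \<noteq> 0" using z(2) E_scale[of 0 z] by auto
  have y: "E z \<in> Z" "T (E z) = T z"
    using orb_in_Z[OF z(1), of 0] tangent_orb[OF z(1) z0, of 0] z(2) by (simp_all add: orb_def)
  obtain r where r: "r \<in> I" "hvec r z = v" using tangent_hvec[OF z(1) z0 v] .
  obtain p where p: "p \<in> I" "hvec p (E z) = hvec q z"
    using tangent_hvec[OF y(1) z(2)] hvec_tangent[OF q z(1) z0] y(2) by metis
  let ?L = "\<lambda>x. dderiv (hvec p x) (dderiv u r) z" and ?R = "dderiv u (dderiv v p)"
  have "polyfun ?L"
    by (rule polyfun_compose[OF polyfun_linear_form[OF dderiv_linear]])
       (simp_all add: polyfun_dderiv I_polyfun r p polyfun_hvec[OF compatible_linear[OF compatible_id]])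
  then have "isCont (\<lambda>s. ?L (E z + s *s z)) 0" by (rule polyfun_continuous_on_line)
  moreover have "polyfun ?R" by (intro polyfun_dderiv I_polyfun[OF p(1)])
  then have "isCont (\<lambda>s. ?R (E z + s *s z)) 0" by (rule polyfun_continuous_on_line)
  then have "isCont (\<lambda>s. s * ?R (E z + s *s z)) 0" by (intro continuous_intros)
  moreover have "?L (orb s z) = s * ?R (orb s z)" if s: "s \<noteq> 0" "s \<noteq> - c" for s
  proof -
    have "?L (orb s z) = dderiv (E u + s *s u) (dderiv v p) (orb s z)"
      using hessian_orb[OF z(1) z0 s u p(1) r(1)] r
      by (simp add: dderiv_commute I_polyfun orb_def[of s u])
    also have "\<dots> = s * ?R (orb s z)"
      using orth[OF s p(1)] by (simp add: dderiv_add_dir dderiv_scale polyfun_dderiv I_polyfun p)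
    finally show ?thesis .
  qed
  ultimately have "?L (E z + 0 *s z) = 0 * ?R (E z + 0 *s z)"
    unfolding orb_def
    by (intro limit_point_eq[where g = "\<lambda>s. ?L (E z + s *s z)" and a = 0 and
          h = "\<lambda>s. s * ?R (E z + s *s z)" and S = "{- c}", OF _ _ finite.insertI[OF finite.emptyI]])
       (assumption | simp)+
  then have "dderiv u (dderiv (hvec q z) r) z = 0"
    using p(2) by (simp add: dderiv_commute I_polyfun r)
  then show ?thesis using hessian_exchange_id[OF z(1) z0 u q r(1)] r(2) by simp
qed

lemma kernel_flat:
  assumes "z \<in> Z" "E z \<noteq> 0" "u \<in> T z" "E u = 0" "v \<in> T z" "q \<in> I"
  shows "dderiv u (dderiv v q) z = 0"
  by (rule hessian_limit) (use assms in simp_all)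

text \<open>Here \<open>E u\<close> lies in the kernel of \<open>E\<close>, so \<open>kernel_flat\<close> at the points \<open>s z + E z\<close> provides the
  hypothesis of \<open>hessian_limit\<close> for every \<open>u\<close>.\<close>

lemma nilpotent_flat:
  assumes c: "c = 0" and z: "z \<in> Z" "E z \<noteq> 0" and u: "u \<in> T z" and v: "v \<in> T z" and q: "q \<in> I"
  shows "dderiv u (dderiv v q) z = 0"
proof (rule hessian_limit[OF z u v _ q])
  fix s p assume s: "s \<noteq> 0" "s \<noteq> - c" and p: "p \<in> I"
  have z0: "z \<noteq> 0" using z(2) E_scale[of 0 z] by auto
  have y: "orb s z \<in> Z" "E (orb s z) \<noteq> 0" "T (orb s z) = T z"
    using z z0 s c orb_in_Z tangent_orb orb_nonzero by (auto simp: E_orb)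
  show "dderiv (E u) (dderiv v p) (orb s z) = 0"
    by (rule kernel_flat) (use y u v p c z z0 in \<open>auto simp: square intro: compatible_T[OF compat]\<close>)
qed

end

text \<open>For \<open>c \<noteq> 0\<close> this is, up to scaling, the projection onto the other eigenspace.\<close>

lemma (in quadratic_operator) complementary:
  "quadratic_operator \<omega> Z (\<lambda>x. E x - c *s x) (- c)"
proof unfold_locales
  show "compatible (\<lambda>x. E x - c *s x)"
    using compatible_shift[OF compat, of "- c"] by simp
  have [simp]: "E (x - y) = E x - E y" for x y
    using E_add[of "x - y" y] by simp
  show "E (E x - c *s x) - c *s (E x - c *s x) = (- c) *s (E x - c *s x)" for x
    by (simp add: E_scale square vec_eq_iff)
qed

text \<open>For \<open>c \<noteq> 0\<close> every tangent vector is the sum of one in the kernel of \<open>E\<close> and one in the kernel of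
  the complementary operator, and both kinds are covered by \<open>kernel_flat\<close>.\<close>

lemma (in quadratic_operator) generic_flat:
  assumes z: "z \<in> Z" "E z \<noteq> 0" "E z \<noteq> c *s z" and u: "u \<in> T z" and v: "v \<in> T z" and q: "q \<in> I"
  shows "dderiv u (dderiv v q) z = 0"
proof (cases "c = 0")
  case True
  then show ?thesis using nilpotent_flat assms by blast
next
  case False
  interpret E': quadratic_operator \<omega> Z "\<lambda>x. E x - c *s x" "- c" by (rule complementary)
  have z0: "z \<noteq> 0" using z(2) E_scale[of 0 z] by auto
  have Eu: "E u \<in> T z" "E u - c *s u \<in> T z"
    using compatible_T[OF compat] compatible_T[OF E'.compat] z z0 u by auto
  have "dderiv (E u) (dderiv v q) z = 0"
    by (rule E'.kernel_flat) (use z Eu v q in \<open>auto simp: square\<close>)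
  moreover have "E (E u - c *s u) = 0"
    using E_add[of "E u - c *s u" "c *s u"] by (simp add: square E_scale)
  then have "dderiv (E u - c *s u) (dderiv v q) z = 0"
    by (intro kernel_flat) (use z Eu v q in auto)
  moreover have "E u = (E u - c *s u) + c *s u" by simp
  ultimately have "c * dderiv u (dderiv v q) z = 0"
    by (metis (no_types, lifting) I_polyfun add.left_neutral dderiv_add_dir dderiv_scale polyfun_dderiv q)
  with False show ?thesis by simp
qed

section \<open>Higher derivatives along the tangent spaces\<close>

lemma polyfun_dderiv_iter: "polyfun f \<Longrightarrow> polyfun ((dderiv u ^^ k) f)"
  by (induction k) (auto intro: polyfun_dderiv)

lemma dderiv_iter_sum:
  assumes "finite A" "\<And>i. i \<in> A \<Longrightarrow> polyfun (g i)"
  shows "(dderiv u ^^ k) (\<lambda>x. \<Sum>i\<in>A. a i * g i x) = (\<lambda>x. \<Sum>i\<in>A. a i * (dderiv u ^^ k) (g i) x)"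
proof (induction k)
  case (Suc k)
  have "dderiv u (\<lambda>x. \<Sum>i\<in>A. a i * (dderiv u ^^ k) (g i) x) =
      (\<lambda>x. \<Sum>i\<in>A. a i * dderiv u ((dderiv u ^^ k) (g i)) x)"
    using assms by (intro ext) (simp add: dderiv_sum dderiv_cmult polyfun_cmult polyfun_dderiv_iter)
  with Suc show ?case by simp
qed simp

lemma dderiv_iter_Suc_coordinates:
  assumes "polyfun f"
  shows "(dderiv u ^^ Suc k) f x = (\<Sum>i\<in>UNIV. u $ i * (dderiv u ^^ k) (dderiv (axis i 1) f) x)"
proof -
  have "dderiv u f = (\<lambda>x. \<Sum>i\<in>UNIV. u $ i * dderiv (axis i 1) f x)"
    by (rule ext) (rule dderiv_coordinates[OF assms])
  then have "(dderiv u ^^ k) (dderiv u f) = (dderiv u ^^ k) (\<lambda>x. \<Sum>i\<in>UNIV. u $ i * dderiv (axis i 1) f x)"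
    by (rule arg_cong)
  then show ?thesis
    by (simp only: funpow_Suc_right o_apply dderiv_iter_sum[OF finite polyfun_dderiv[OF assms]])
qed

lemma polyfun_dderiv_iter_field:
  assumes "\<And>i. polyfun (\<lambda>x. \<xi> x $ i)"
  shows "polyfun f \<Longrightarrow> polyfun (\<lambda>x. (dderiv (\<xi> x) ^^ k) f x)"
proof (induction k arbitrary: f)
  case (Suc k)
  show ?case
    unfolding dderiv_iter_Suc_coordinates[OF Suc.prems]
    by (intro polyfun_sum polyfun.mult assms Suc.IH polyfun_dderiv Suc.prems)
qed simp

text \<open>Joint differentiability in the point and the direction lets the chain rule split the derivative of
  \<open>D\<^sub>\<xi>\<^sup>k f\<close>, for a vector field \<open>\<xi>\<close>, into a part that moves the point and a part that moves \<open>\<xi>\<close>.\<close>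

lemma dderiv_iter_differentiable:
  fixes f :: "complex^'m \<Rightarrow> complex"
  shows "polyfun f \<Longrightarrow> (\<lambda>p. (dderiv (snd p) ^^ k) f (fst p)) differentiable (at p)"
proof (induction k arbitrary: f)
  case 0
  have "f differentiable (at (fst p))"
    using polyfun_has_derivative[OF 0] by (auto simp: differentiable_def)
  then have "f \<circ> fst differentiable (at p)"
    by (intro differentiable_chain_at[of fst] bounded_linear_imp_differentiable[OF bounded_linear_fst])
  then show ?case by (simp add: o_def)
next
  case (Suc k)
  have "(\<lambda>p. snd p $ i) differentiable (at p)" for i :: 'm
    by (intro bounded_linear_imp_differentiable bounded_linear_compose[OF bounded_linear_vec_nth bounded_linear_snd])
  then show ?case
    unfolding dderiv_iter_Suc_coordinates[OF Suc.prems]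
    by (intro differentiable_sum ballI differentiable_mult Suc.IH polyfun_dderiv Suc.prems) auto
qed

lemma (in symplectic_space) hvec_has_derivative:
  assumes f: "polyfun f"
  shows "(hvec f has_derivative (\<lambda>u. hvec (dderiv u f) x)) (at x)"
proof -
  have "((\<lambda>y. \<Sum>i\<in>UNIV. dderiv (axis i 1) f y *s coord_vec i) has_derivative
      (\<lambda>u. \<Sum>i\<in>UNIV. dderiv u (dderiv (axis i 1) f) x *s coord_vec i)) (at x)"
    by (intro has_derivative_sum bounded_linear.has_derivative[OF bounded_linear_scale_vec]
        polyfun_has_derivative polyfun_dderiv f)
  then show ?thesis
    by (simp add: hvec_def[abs_def] dderiv_commute[OF f, of _ "axis _ _"])
qed

context quadratic_operator
begin

definition generic :: "complex^'m \<Rightarrow> bool" where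
  "generic z \<longleftrightarrow> z \<in> Z \<and> E z \<noteq> 0 \<and> E z \<noteq> c *s z"

lemma generic_nonzero: "generic z \<Longrightarrow> z \<noteq> 0"
  using E_scale[of 0 0] by (auto simp: generic_def)

text \<open>The non-generic points of \<open>Z\<close> lie on a hypersurface \<open>l = 0\<close> that misses \<open>z\<close>, so \<open>l f\<close> is in the
  ideal.\<close>

lemma dderiv_generic_zero:
  assumes f: "polyfun f" "\<And>x. generic x \<Longrightarrow> f x = 0" and z: "generic z" and u: "u \<in> T z"
  shows "dderiv u f z = 0"
proof -
  obtain i j where ij: "E z $ i \<noteq> 0" "(E z - c *s z) $ j \<noteq> 0"
    using z by (auto simp: generic_def vec_eq_iff)
  let ?l = "\<lambda>x. E x $ i * (E x $ j - c * x $ j)"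
  have l: "polyfun ?l"
    by (intro polyfun.mult polyfun_diff polyfun_cmult polyfun.coord polyfun_linear_coord
        compatible_linear[OF compat])
  have "?l x * f x = 0" if "x \<in> Z" for x
    using f(2)[of x] that by (cases "generic x") (auto simp: generic_def vec_eq_iff)
  then have "(\<lambda>x. ?l x * f x) \<in> I"
    using l f(1) by (simp add: ideal_of_def polyfun.mult)
  then have "dderiv u (\<lambda>x. ?l x * f x) z = 0" using T_zero u by blast
  moreover have "dderiv u (\<lambda>x. ?l x * f x) z = dderiv u ?l z * f z + ?l z * dderiv u f z"
    using l f(1) by (rule dderiv_mult)
  ultimately show ?thesis using ij f(2)[OF z] by simp
qed

text \<open>Induction on the order. Extend \<open>u\<close> to the Hamiltonian field \<open>H\<^sub>r\<close> and differentiate the identity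
  \<open>D\<^sub>H\<^sup>k f = 0\<close> along \<open>u\<close>. The point part is \<open>D\<^sub>u\<^sup>k\<^sup>+\<^sup>1 f\<close>. The vector part vanishes: the second derivatives
  being zero, the derivative \<open>w\<close> of \<open>H\<^sub>r\<close> is again tangent, and in tangent directions \<open>D\<^sup>k f\<close> is
  identically zero by the induction hypothesis.\<close>

lemma iterated_flat:
  "f \<in> I \<Longrightarrow> generic z \<Longrightarrow> u \<in> T z \<Longrightarrow> (dderiv u ^^ k) f z = 0"
proof (induction k arbitrary: z u)
  case 0
  then show ?case by (simp add: I_zero generic_def)
next
  case (Suc k)
  have z: "z \<in> Z" "z \<noteq> 0" "E z \<noteq> 0" "E z \<noteq> c *s z"
    using Suc.prems generic_nonzero by (auto simp: generic_def)
  have f: "polyfun f" using Suc.prems(1) by (rule I_polyfun)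
  obtain r where r: "r \<in> I" "hvec r z = u" using tangent_hvec[OF z(1,2) Suc.prems(3)] .
  define w where "w = hvec (dderiv u r) z"
  have w: "w \<in> T z"
  proof (rule lagrangian_perpI[OF lagrangian_tangent[OF z(1,2)]])
    fix v assume "v \<in> T z"
    then show "\<omega> w v = 0"
      using generic_flat[OF z(1,3,4) \<open>v \<in> T z\<close> Suc.prems(3) r(1)]
      by (simp add: w_def omega_hvec polyfun_dderiv I_polyfun r(1))
  qed
  let ?J = "\<lambda>p. (dderiv (snd p) ^^ k) f (fst p)"
  obtain J' where J': "(?J has_derivative J') (at (z, u))"
    using dderiv_iter_differentiable[OF f, of k "(z, u)"] unfolding differentiable_def by blast
  let ?\<phi> = "\<lambda>x. (dderiv (hvec r x) ^^ k) f x"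
  have \<phi>: "polyfun ?\<phi>"
    by (rule polyfun_dderiv_iter_field[OF _ f]) (rule polyfun_hvec[OF compatible_linear[OF compatible_id] I_polyfun[OF r(1)]])
  have \<phi>0: "dderiv u ?\<phi> z = 0"
    by (rule dderiv_generic_zero[OF \<phi> _ Suc.prems(2,3)])
       (metis Suc.IH Suc.prems(1) generic_def generic_nonzero hvec_tangent r(1))
  \<comment> \<open>The partial derivatives of \<open>?J\<close> at \<open>(z, u)\<close>: jointly, in the point, and in the direction.\<close>
  have "((\<lambda>x. ?J (x, hvec r x)) has_derivative (\<lambda>v. J' (v, hvec (dderiv v r) z))) (at z)"
    by (rule has_derivative_compose[where f = "\<lambda>x. (x, hvec r x)"])
       (use J' r(2) in \<open>auto intro!: derivative_eq_intros hvec_has_derivative I_polyfun r(1)\<close>)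
  then have Juw: "J' (u, w) = dderiv u ?\<phi> z"
    using has_derivative_unique[OF _ polyfun_has_derivative[OF \<phi>, where x = z]] by (auto simp: w_def dest!: fun_cong)
  have "((\<lambda>x. ?J (x, u)) has_derivative (\<lambda>v. J' (v, 0))) (at z)"
    by (rule has_derivative_compose[where f = "\<lambda>x. (x, u)"])
       (use J' in \<open>auto intro!: derivative_eq_intros\<close>)
  then have Ju: "J' (u, 0) = dderiv u ((dderiv u ^^ k) f) z"
    using has_derivative_unique[OF _ polyfun_has_derivative[OF polyfun_dderiv_iter[OF f], where x = z]]
    by (auto dest!: fun_cong)
  have "((\<lambda>t::real. ?J (z, u + t *\<^sub>R w)) has_derivative (\<lambda>t. J' (0, t *\<^sub>R w))) (at 0)"
    by (rule has_derivative_compose[where f = "\<lambda>t. (z, u + t *\<^sub>R w)"])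
       (use J' in \<open>auto intro!: derivative_eq_intros\<close>)
  moreover have "u + t *\<^sub>R w \<in> T z" for t :: real
  proof -
    have "t *\<^sub>R w = complex_of_real t *s w" by (simp add: vec_eq_iff) (simp add: scaleR_conv_of_real)
    then show ?thesis
      using vec.subspace_add[OF subspace_tangent_space Suc.prems(3) vec.subspace_scale[OF subspace_tangent_space w]]
      by simp
  qed
  then have "?J (z, u + t *\<^sub>R w) = 0" for t :: real
    using Suc.IH[OF Suc.prems(1,2)] by simp
  ultimately have "((\<lambda>t::real. 0::complex) has_derivative (\<lambda>t. J' (0, t *\<^sub>R w))) (at 0)"
    by simp
  then have Jw: "J' (0, w) = 0"
    using has_derivative_unique[OF _ has_derivative_const[of "0::complex" "at (0::real)"]]
    by (metis scaleR_one)
  have "J' (u, w) = J' (u, 0) + J' (0, w)"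
    using linear_add[OF has_derivative_linear[OF J'], of "(u, 0)" "(0, w)"] by simp
  then show ?case using \<phi>0 Juw Ju Jw by simp
qed

text \<open>Taylor's formula along the line from \<open>z\<close> to a point of \<open>T z\<close>.\<close>

lemma tangent_subset:
  assumes z: "generic z" shows "T z \<subseteq> Z"
proof
  fix x assume x: "x \<in> T z"
  have u: "x - z \<in> T z"
    using z x by (auto simp: generic_def intro!: vec.subspace_diff subspace_tangent_space radial_tangent)
  let ?u = "x - z"
  show "x \<in> Z"
  proof (rule closed)
    fix f assume f: "f \<in> I"
    let ?\<P> = "{P. \<exists>k. \<forall>t. (dderiv ?u ^^ k) f (z + t *s ?u) = poly P t}"
    obtain P where P: "\<forall>t. f (z + t *s ?u) = poly P t"
      using polyfun_on_line[OF I_polyfun[OF f]] by blast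
    have "P = 0"
    proof (rule stable_polys_zero[of ?\<P> 0])
      fix P assume "P \<in> ?\<P>"
      then obtain k where P: "\<And>t. (dderiv ?u ^^ k) f (z + t *s ?u) = poly P t" by blast
      show "poly P 0 = 0" using P[of 0] iterated_flat[OF f z u, of k] by simp
      show "[:1, 0:] * pderiv P \<in> ?\<P>"
        using polyfun_on_line_dderiv[OF polyfun_dderiv_iter[OF I_polyfun[OF f]] P]
        by (auto intro!: exI[of _ "Suc k"])
    next
      show "P \<in> ?\<P>" using P by (auto intro!: exI[of _ 0])
    qed
    then show "f x = 0" using P[rule_format, of 1] by simp
  qed
qed

end

section \<open>Polynomials in an operator\<close>

locale linear_operator =
  fixes B :: "complex^'m \<Rightarrow> complex^'m"
  assumes lin: "Vector_Spaces.linear (*s) (*s) B"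
begin

lemma B_add: "B (x + y) = B x + B y" and B_scale: "B (k *s x) = k *s B x"
  using lin by (auto simp: Vector_Spaces.linear_iff)

lemma B_zero [simp]: "B 0 = 0"
  using B_scale[of 0 0] by simp

definition op_poly :: "complex poly \<Rightarrow> complex^'m \<Rightarrow> complex^'m" where
  "op_poly p = fold_coeffs (\<lambda>a g x. a *s x + B (g x)) p (\<lambda>_. 0)"

lemma op_poly_0 [simp]: "op_poly 0 x = 0"
  by (simp add: op_poly_def)

lemma op_poly_pCons [simp]: "op_poly (pCons a p) x = a *s x + B (op_poly p x)"
  by (cases "a = 0 \<and> p = 0") (auto simp: op_poly_def)

lemma op_poly_add: "op_poly (p + q) x = op_poly p x + op_poly q x"
  by (induction p q rule: poly_induct2) (auto simp: B_add vec.scale_left_distrib)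

lemma op_poly_smult: "op_poly (smult a p) x = a *s op_poly p x"
  by (induction p) (auto simp: B_scale vec.scale_right_distrib)

lemma op_poly_mult: "op_poly (p * q) x = op_poly p (op_poly q x)"
  by (induction p) (auto simp: op_poly_add op_poly_smult)

lemma op_poly_sum: "op_poly (\<Sum>i\<in>A. p i) x = (\<Sum>i\<in>A. op_poly (p i) x)"
  by (induction A rule: infinite_finite_induct) (auto simp: op_poly_add)

lemma op_poly_linear: "Vector_Spaces.linear (*s) (*s) (op_poly p)"
proof -
  have "op_poly p (x + y) = op_poly p x + op_poly p y" for x y
    by (induction p) (simp_all add: B_add vec.scale_right_distrib)
  moreover have "op_poly p (k *s x) = k *s op_poly p x" for k x
    by (induction p) (auto simp: B_scale vec.scale_right_distrib mult.commute)
  ultimately show ?thesis by (simp add: Vector_Spaces.linear_iff vec.vector_space_axioms)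
qed

lemma op_poly_commute: "op_poly p (B x) = B (op_poly p x)"
  by (induction p) (auto simp: B_add B_scale)

lemma op_poly_monom: "op_poly (monom a k) x = a *s (B ^^ k) x"
  by (induction k) (auto simp: monom_0 monom_Suc B_scale)

text \<open>The powers of \<open>B\<close> applied to \<open>v\<close> either repeat or are linearly dependent, being infinitely many.\<close>

lemma annihilating_poly_vector: "\<exists>p. p \<noteq> 0 \<and> op_poly p v = 0"
proof (cases "inj (\<lambda>k. (B ^^ k) v)")
  case False
  then obtain i j where ij: "i \<noteq> j" "(B ^^ i) v = (B ^^ j) v" by (auto simp: inj_def)
  let ?p = "monom 1 i + monom (- 1) j :: complex poly"
  have "coeff ?p i \<noteq> 0" using ij by simp
  then have "?p \<noteq> 0" by (metis coeff_0)
  moreover have "op_poly ?p v = 0" using ij by (simp add: op_poly_add op_poly_monom vec_eq_iff)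
  ultimately show ?thesis by blast
next
  case inj: True
  let ?f = "\<lambda>k. (B ^^ k) v"
  have "infinite (range ?f)" using inj by (simp add: finite_image_iff)
  then have "vec.dependent (range ?f)" using vec.finiteI_independent by blast
  then obtain t u where t: "finite t" "t \<subseteq> range ?f" "(\<Sum>x\<in>t. u x *s x) = 0" "\<exists>x\<in>t. u x \<noteq> 0"
    unfolding vec.dependent_explicit by blast
  then obtain A where A: "t = ?f ` A" "finite A"
    using finite_subset_image[OF t(1,2)] by blast
  have injA: "inj_on ?f A" using inj by (rule inj_on_subset) simp
  let ?p = "\<Sum>k\<in>A. monom (u (?f k)) k"
  obtain k where "k \<in> A" "u (?f k) \<noteq> 0" using t(4) A(1) by blast
  then have "coeff ?p k \<noteq> 0" by (simp add: coeff_sum A(2))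
  then have "?p \<noteq> 0" by (metis coeff_0)
  moreover have "op_poly ?p v = 0"
    using t(3) by (simp add: op_poly_sum op_poly_monom A(1) sum.reindex[OF injA])
  ultimately show ?thesis by blast
qed

lemma annihilating_poly: "\<exists>p. p \<noteq> 0 \<and> (\<forall>x. op_poly p x = 0)"
proof -
  obtain p where p: "\<And>i. p i \<noteq> 0" "\<And>i. op_poly (p i) (axis i 1) = 0"
    using annihilating_poly_vector[of "axis _ 1"] by metis
  interpret o: Vector_Spaces.linear "(*s)" "(*s)" "op_poly (\<Prod>i\<in>UNIV. p i)" by (rule op_poly_linear)
  have "op_poly (\<Prod>i\<in>UNIV. p i) (axis j 1) = 0" for j
  proof -
    have split: "(\<Prod>i\<in>UNIV. p i) = (\<Prod>i\<in>UNIV - {j}. p i) * p j"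
      by (subst prod.remove[of UNIV j]) (auto simp: mult.commute)
    interpret o': Vector_Spaces.linear "(*s)" "(*s)" "op_poly (\<Prod>i\<in>UNIV - {j}. p i)"
      by (rule op_poly_linear)
    show ?thesis using split by (simp add: op_poly_mult p)
  qed
  then have "op_poly (\<Prod>i\<in>UNIV. p i) x = 0" for x
    by (subst linear_coordinates[OF op_poly_linear]) simp
  moreover have "(\<Prod>i\<in>UNIV. p i) \<noteq> 0" using p(1) by simp
  ultimately show ?thesis by blast
qed

text \<open>Let \<open>(X - a) q\<close> be the minimal polynomial of \<open>B\<close>. Then \<open>q(B) \<noteq> 0\<close> has its image in the eigenspace
  of \<open>a\<close>, so every polynomial in \<open>B\<close>, in particular \<open>q(B)\<close> itself, acts on this image by its value
  at \<open>a\<close>. Hence \<open>q(B)\<^sup>2 = q(a) q(B)\<close>.\<close>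

lemma quadratic_in_algebra:
  assumes "\<nexists>a. \<forall>x. B x = a *s x"
  obtains p c where "\<And>x. op_poly p (op_poly p x) = c *s op_poly p x"
    and "\<exists>x. op_poly p x \<noteq> 0" and "\<exists>x. op_poly p x \<noteq> c *s x"
proof -
  define Q where "Q p \<longleftrightarrow> p \<noteq> 0 \<and> (\<forall>x. op_poly p x = 0)" for p
  have "\<exists>p. Q p" using annihilating_poly by (auto simp: Q_def)
  then obtain p where p: "Q p" and min: "\<And>q. Q q \<Longrightarrow> degree p \<le> degree q"
    using ex_has_least_nat[of Q _ degree] by blast
  have "degree p \<noteq> 0"
  proof
    assume "degree p = 0"
    then obtain a where "p = [:a:]" by (metis degree_eq_zeroE)
    then have "a \<noteq> 0" "a *s axis undefined (1::complex) = (0 :: complex^'m)"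
      using p by (auto simp: Q_def)
    then have "a * axis undefined 1 $ (undefined :: 'm) = 0" by (metis vector_smult_component zero_index)
    with \<open>a \<noteq> 0\<close> show False by simp
  qed
  then obtain a where "poly p a = 0"
    using fundamental_theorem_of_algebra[of p] constant_degree[of p] by metis
  then obtain q where q: "p = [:- a, 1:] * q" by (auto simp: poly_eq_0_iff_dvd)
  have "q \<noteq> 0" using p q by (auto simp: Q_def)
  have "degree q < degree p"
    unfolding q using \<open>q \<noteq> 0\<close> by (subst degree_mult_eq) auto
  then have E: "\<exists>x. op_poly q x \<noteq> 0" using min[of q] \<open>q \<noteq> 0\<close> by (auto simp: Q_def)
  have Bq: "B (op_poly q x) = a *s op_poly q x" for x
  proof -
    have "op_poly ([:- a, 1:] * q) x = 0" using p q by (simp add: Q_def)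
    then have "- a *s op_poly q x + B (op_poly q x) = 0" by (simp only: op_poly_mult op_poly_pCons op_poly_0 B_zero) simp
    then show ?thesis by (simp add: vec_eq_iff add_eq_0_iff)
  qed
  have "op_poly r (op_poly q x) = poly r a *s op_poly q x" for r x
    by (induction r) (auto simp: B_scale Bq vec.scale_left_distrib mult.commute)
  moreover have "\<exists>x. op_poly q x \<noteq> poly q a *s x"
  proof (rule ccontr)
    assume "\<not> ?thesis"
    then have qx: "op_poly q x = poly q a *s x" for x by blast
    then have "poly q a \<noteq> 0" using E by auto
    moreover have "poly q a *s B x = poly q a *s (a *s x)" for x
      using Bq[of x] vec.scale_left_commute[of a "poly q a" x] unfolding qx B_scale by (rule trans)
    ultimately have "B x = a *s x" for x by (metis vec.scale_cancel_left)
    then show False using assms by blast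
  qed
  ultimately show ?thesis using that E by blast
qed

end

lemma (in legendrian_cone) compatible_op_poly:
  assumes B: "compatible B" shows "compatible (linear_operator.op_poly B p)"
proof -
  interpret linear_operator B by (rule linear_operator.intro) (rule compatible_linear[OF B])
  have "\<omega> (op_poly p u) v = \<omega> u (op_poly p v)" for u v
    by (induction p arbitrary: u v)
       (auto simp: add_left add_right scale_left scale_right compatible_adj[OF B] op_poly_commute)
  moreover have "op_poly p u \<in> T x" if "x \<in> Z" "x \<noteq> 0" "u \<in> T x" for x u
  proof (induction p)
    case 0
    show ?case using vec.subspace_0[OF subspace_tangent_space] by simp
  next
    case (pCons a p)
    then show ?case
      using that by (simp add: vec.subspace_add vec.subspace_scale subspace_tangent_space compatible_T[OF B])
  qed
  ultimately show ?thesis by (simp add: compatible_def self_adjoint_def op_poly_linear)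
qed

section \<open>The Zariski topologies\<close>

lemma zariski_affine_open_contains:
  assumes "openin zariski_affine S" "x \<in> S"
  shows "\<exists>f. polyfun f \<and> f x \<noteq> 0 \<and> {v. f v \<noteq> 0} \<subseteq> S"
proof -
  have "generate_topology_on {{v. vec_eval p v \<noteq> 0} | p :: 'a cpoly. True} S"
    using assms(1) by (simp add: zariski_affine_def openin_topology_generated_by_iff)
  then show ?thesis using assms(2)
  proof induction
    case (Int a b)
    then obtain f g where f: "polyfun f" "f x \<noteq> 0" "{v. f v \<noteq> 0} \<subseteq> a"
      and g: "polyfun g" "g x \<noteq> 0" "{v. g v \<noteq> 0} \<subseteq> b" by blast
    then show ?case by (intro exI[of _ "\<lambda>v. f v * g v"]) (auto intro: polyfun.mult)
  next
    case (UN K)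
    then obtain k where "k \<in> K" "x \<in> k" by blast
    with UN.IH show ?case by (meson Union_upper order_trans)
  next
    case (Basis s)
    then obtain p where "s = {v. vec_eval p v \<noteq> 0}" by blast
    with Basis show ?case by (intro exI[of _ "vec_eval p"]) (auto intro: polyfun_vec_eval)
  qed simp
qed

lemma zariski_affine_basic_open: "polyfun f \<Longrightarrow> openin zariski_affine {v. f v \<noteq> 0}"
  unfolding zariski_affine_def polyfun_iff
  by (rule topology_generated_by_Basis) blast

lemma topspace_zariski_affine [simp]: "topspace zariski_affine = UNIV"
  using openin_subset[OF zariski_affine_basic_open[OF polyfun.const[of 1]]] by auto

lemma closedin_zariski_affine_zeros: "polyfun f \<Longrightarrow> closedin zariski_affine {v. f v = 0}"
  using zariski_affine_basic_open[of f] by (simp add: closedin_def Compl_eq[symmetric] Compl_eq_Diff_UNIV[symmetric] Collect_neg_eq[symmetric])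

lemma closedin_zariski_affine_common_zeros:
  assumes "\<And>f. f \<in> F \<Longrightarrow> polyfun f"
  shows "closedin zariski_affine {v. \<forall>f\<in>F. f v = 0}"
proof (cases "F = {}")
  case True
  then show ?thesis using closedin_topspace[of zariski_affine] by simp
next
  case False
  have "{v. \<forall>f\<in>F. f v = 0} = (\<Inter>f\<in>F. {v. f v = 0})" by auto
  then show ?thesis using False assms by (auto intro!: closedin_Inter closedin_zariski_affine_zeros)
qed

lemma zariski_affine_separate:
  assumes "closedin zariski_affine A" "x \<notin> A"
  obtains f where "polyfun f" "f x \<noteq> 0" "\<And>v. v \<in> A \<Longrightarrow> f v = 0"
proof -
  have "openin zariski_affine (UNIV - A)" using assms(1) by (simp add: closedin_def)
  then obtain f where "polyfun f" "f x \<noteq> 0" "{v. f v \<noteq> 0} \<subseteq> UNIV - A"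
    using zariski_affine_open_contains[of "UNIV - A" x] assms(2) by auto
  then show ?thesis using that by blast
qed

lemma closedin_zariski_affine_singleton: "closedin zariski_affine {z}"
proof -
  have "{z} = {v. \<forall>f\<in>range (\<lambda>i v. v $ i - z $ i). f v = 0}"
    by (auto simp: vec_eq_iff)
  also have "closedin zariski_affine \<dots>"
    by (rule closedin_zariski_affine_common_zeros) (auto intro!: polyfun_diff polyfun.intros)
  finally show ?thesis .
qed

lemma closedin_zariski_affine_kernel:
  assumes "Vector_Spaces.linear (*s) (*s) (F :: complex^'m \<Rightarrow> complex^'m)"
  shows "closedin zariski_affine {x. F x = 0}"
proof -
  have "{x. F x = 0} = {v. \<forall>f\<in>range (\<lambda>i v. F v $ i). f v = 0}"
    by (auto simp: vec_eq_iff)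
  also have "closedin zariski_affine \<dots>"
    by (rule closedin_zariski_affine_common_zeros) (auto intro!: polyfun_linear_coord assms)
  finally show ?thesis .
qed

lemma (in symplectic_space) closedin_zariski_affine_subspace:
  fixes W :: "(complex^'m) set"
  assumes "vec.subspace W" shows "closedin zariski_affine W"
proof -
  have "W = {v. \<forall>f\<in>{\<omega> y | y. \<forall>s\<in>W. \<omega> y s = 0}. f v = 0}"
    using double_perp[OF assms] by blast
  also have "closedin zariski_affine \<dots>"
    by (rule closedin_zariski_affine_common_zeros) (auto intro!: polyfun_linear_form linear_right)
  finally show ?thesis .
qed

lemma line_zero_product:
  assumes "polyfun f" "polyfun g" "\<And>t. f (x + t *s u) * g (x + t *s u) = 0"
  shows "(\<forall>t. f (x + t *s u) = 0) \<or> (\<forall>t. g (x + t *s u) = 0)"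
proof -
  obtain P Q where P: "\<And>t. f (x + t *s u) = poly P t" and Q: "\<And>t. g (x + t *s u) = poly Q t"
    using polyfun_on_line assms(1,2) by metis
  have "poly (P * Q) = (\<lambda>_. 0)" using assms(3) by (auto simp: P Q)
  then have "P * Q = 0" using poly_all_0_iff_0 by metis
  then show ?thesis by (auto simp: P Q)
qed

text \<open>Two points of \<open>S\<close> outside \<open>A\<close> and outside \<open>B\<close> span a line on which the product of two nonzero
  univariate polynomials would vanish.\<close>

lemma irreducible_if_lines:
  assumes "S \<noteq> {}" "\<And>a b t. a \<in> S \<Longrightarrow> b \<in> S \<Longrightarrow> a + t *s (b - a) \<in> S"
  shows "irreducible_in zariski_affine S"
  unfolding irreducible_in_def
proof (intro conjI allI impI)
  fix A B assume AB: "closedin zariski_affine A \<and> closedin zariski_affine B \<and> S \<subseteq> A \<union> B"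
  show "S \<subseteq> A \<or> S \<subseteq> B"
  proof (rule ccontr)
    assume "\<not> ?thesis"
    then obtain a b where a: "a \<in> S" "a \<notin> A" and b: "b \<in> S" "b \<notin> B" by blast
    obtain f where f: "polyfun f" "f a \<noteq> 0" "\<And>v. v \<in> A \<Longrightarrow> f v = 0"
      using zariski_affine_separate AB a(2) by blast
    obtain g where g: "polyfun g" "g b \<noteq> 0" "\<And>v. v \<in> B \<Longrightarrow> g v = 0"
      using zariski_affine_separate AB b(2) by blast
    have "f (a + t *s (b - a)) * g (a + t *s (b - a)) = 0" for t
      using assms(2)[OF a(1) b(1), of t] AB f(3) g(3) by auto
    from line_zero_product[OF f(1) g(1) this] f(2) g(2) show False
      by (auto dest: spec[of _ 0] spec[of _ 1])
  qed
qed (use assms in auto)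

lemma homogeneous_iff:
  "homogeneous p \<longleftrightarrow> (\<exists>d. \<forall>m\<in>Poly_Mapping.keys p. monom_degree m = d)"
  by (simp add: homogeneous_def monom_degree_def)

lemma monom_eval_scale: "monom_eval m (\<lambda>i. c * v i) = c ^ monom_degree m * monom_eval m v"
  by (simp add: monom_eval_def monom_degree_def power_mult_distrib prod.distrib power_sum)

lemma vec_eval_alt: "poly_eval p v = (\<Sum>m\<in>Poly_Mapping.keys p. Poly_Mapping.lookup p m * monom_eval m v)"
  by (simp add: poly_eval_def monom_eval_def)

lemma homogeneous_degree_scale:
  assumes "\<forall>m\<in>Poly_Mapping.keys p. monom_degree m = d"
  shows "vec_eval p (c *s v) = c ^ d * vec_eval p v"
  using assms by (simp add: vec_eval_alt monom_eval_scale sum_distrib_left mult_ac)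

lemma homogeneous_scale:
  assumes "homogeneous p" shows "\<exists>d. \<forall>c v. vec_eval p (c *s v) = c ^ d * vec_eval p v"
  using assms homogeneous_degree_scale unfolding homogeneous_iff by blast

lemma homogeneous_mult:
  assumes "homogeneous p" "homogeneous q" shows "homogeneous (p * q)"
proof -
  obtain d e where "\<forall>m\<in>Poly_Mapping.keys p. monom_degree m = d"
    "\<forall>m\<in>Poly_Mapping.keys q. monom_degree m = e"
    using assms by (auto simp: homogeneous_iff)
  then have "\<forall>m\<in>Poly_Mapping.keys (p * q). monom_degree m = d + e"
    using Poly_Mapping.keys_mult[of p q] by (auto simp: monom_degree_add)
  then show ?thesis by (auto simp: homogeneous_iff)
qed

definition hom_part :: "nat \<Rightarrow> 'i cpoly \<Rightarrow> 'i cpoly" where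
  "hom_part d p = (\<Sum>m\<in>{m\<in>Poly_Mapping.keys p. monom_degree m = d}.
     Poly_Mapping.single m (Poly_Mapping.lookup p m))"

lemma keys_hom_part: "m \<in> Poly_Mapping.keys (hom_part d p) \<Longrightarrow> monom_degree m = d"
  using Poly_Mapping.keys_sum[of "\<lambda>m. Poly_Mapping.single m (Poly_Mapping.lookup p m)"
      "{m\<in>Poly_Mapping.keys p. monom_degree m = d}"]
  by (auto simp: hom_part_def split: if_splits)

lemma homogeneous_hom_part: "homogeneous (hom_part d p)"
  unfolding homogeneous_iff by (intro exI[of _ d] ballI keys_hom_part)

lemma poly_eval_hom_parts:
  "poly_eval p v = (\<Sum>d\<in>monom_degree ` Poly_Mapping.keys p. poly_eval (hom_part d p) v)"
  by (simp add: hom_part_def poly_eval_sum vec_eval_alt[of p]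
      sum.image_gen[of "Poly_Mapping.keys p" _ monom_degree])

text \<open>The values of the homogeneous parts at \<open>v\<close> are the coefficients of \<open>p (t v)\<close> as a polynomial in
  \<open>t\<close>.\<close>

lemma hom_parts_vanish_on_line:
  assumes "\<And>t. vec_eval p (t *s v) = 0"
  shows "\<forall>d\<in>monom_degree ` Poly_Mapping.keys p. vec_eval (hom_part d p) v = 0"
proof
  let ?D = "monom_degree ` Poly_Mapping.keys p"
  fix d assume d: "d \<in> ?D"
  let ?P = "\<Sum>d\<in>?D. monom (vec_eval (hom_part d p) v) d"
  have "poly ?P t = 0" for t
  proof -
    have "poly ?P t = (\<Sum>d\<in>?D. t ^ d * vec_eval (hom_part d p) v)"
      by (simp add: poly_sum poly_monom mult.commute)
    also have "\<dots> = (\<Sum>d\<in>?D. vec_eval (hom_part d p) (t *s v))"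
      by (intro sum.cong refl homogeneous_degree_scale[symmetric]) (auto dest: keys_hom_part)
    also have "\<dots> = 0" using assms[of t] by (subst (asm) poly_eval_hom_parts)
    finally show ?thesis .
  qed
  then have "?P = 0" by (simp add: poly_all_0_iff_0[symmetric])
  then have "coeff ?P d = 0" by simp
  then show "vec_eval (hom_part d p) v = 0" using d by (simp add: coeff_sum)
qed

lemma line_generator:
  assumes "vec.span {w} = vec.span {v :: complex^'m}" shows "\<exists>c. w = c *s v"
proof -
  have "w \<in> vec.span {v}" using assms vec.span_base by blast
  then show ?thesis by (auto simp: vec.span_singleton)
qed

lemma zariski_proj_open_contains:
  assumes "openin zariski_proj S" "v \<noteq> 0" "vec.span {v} \<in> S"
  shows "\<exists>p. homogeneous p \<and> vec_eval p v \<noteq> 0 \<and>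
    (\<forall>w. w \<noteq> 0 \<longrightarrow> vec_eval p w \<noteq> 0 \<longrightarrow> vec.span {w} \<in> S)"
proof -
  have "generate_topology_on {{vec.span {v} | v. v \<noteq> 0 \<and> vec_eval p v \<noteq> 0} | p. homogeneous p} S"
    using assms(1) by (simp add: zariski_proj_def openin_topology_generated_by_iff)
  then show ?thesis using assms(2,3)
  proof induction
    case (Int a b)
    then obtain p q where p: "homogeneous p" "vec_eval p v \<noteq> 0"
        "\<forall>w. w \<noteq> 0 \<longrightarrow> vec_eval p w \<noteq> 0 \<longrightarrow> vec.span {w} \<in> a"
      and q: "homogeneous q" "vec_eval q v \<noteq> 0"
        "\<forall>w. w \<noteq> 0 \<longrightarrow> vec_eval q w \<noteq> 0 \<longrightarrow> vec.span {w} \<in> b" by blast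
    then show ?case
      by (intro exI[of _ "p * q"]) (auto simp: poly_eval_mult intro: homogeneous_mult)
  next
    case (UN K)
    then obtain k where k: "k \<in> K" "vec.span {v} \<in> k" by blast
    with UN.IH[OF k(1) UN.prems(1) k(2)] show ?case by blast
  next
    case (Basis s)
    then obtain p where p: "homogeneous p" "s = {vec.span {v} | v. v \<noteq> 0 \<and> vec_eval p v \<noteq> 0}"
      by blast
    obtain d where d: "\<And>c v. vec_eval p (c *s v) = c ^ d * vec_eval p v"
      using homogeneous_scale[OF p(1)] by blast
    obtain w where w: "vec.span {w} = vec.span {v}" "w \<noteq> 0" "vec_eval p w \<noteq> 0"
      using Basis.prems(2) p(2) by auto
    then obtain c where "w = c *s v" using line_generator by blast
    then have "vec_eval p v \<noteq> 0" using w(3) d by auto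
    with p show ?case by blast
  qed simp
qed

lemma zariski_proj_basic_open:
  "homogeneous p \<Longrightarrow> openin zariski_proj {vec.span {v} | v. v \<noteq> 0 \<and> vec_eval p v \<noteq> 0}"
  unfolding zariski_proj_def by (rule topology_generated_by_Basis) blast

lemma topspace_zariski_proj: "topspace zariski_proj = {vec.span {v} | v. v \<noteq> 0}"
proof
  show "topspace zariski_proj \<subseteq> {vec.span {v} | v. v \<noteq> 0}"
    unfolding zariski_proj_def topology_generated_by_topspace by blast
  let ?p = "Poly_Mapping.single 0 1 :: 'a cpoly"
  have "homogeneous ?p" by (auto simp: homogeneous_iff)
  then have "{vec.span {v} | v. v \<noteq> 0 \<and> vec_eval ?p v \<noteq> 0} \<subseteq> topspace zariski_proj"
    by (intro openin_subset zariski_proj_basic_open)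
  moreover have "vec_eval ?p v \<noteq> 0" for v :: "complex^'a"
    by (simp only: poly_eval_single) (simp add: monom_eval_def)
  ultimately show "{vec.span {v} | v :: complex^'a. v \<noteq> 0} \<subseteq> topspace zariski_proj"
    by (simp only: simp_thms)
qed

lemma closedin_zariski_proj_zeros:
  assumes p: "homogeneous p"
  shows "closedin zariski_proj {vec.span {v} | v. v \<noteq> 0 \<and> vec_eval p v = 0}" (is "closedin _ ?A")
proof -
  obtain d where d: "\<And>c v. vec_eval p (c *s v) = c ^ d * vec_eval p v"
    using homogeneous_scale[OF p] by blast
  have "topspace zariski_proj - ?A = {vec.span {v} | v. v \<noteq> 0 \<and> vec_eval p v \<noteq> 0}"
  proof (intro equalityI subsetI)
    fix L assume "L \<in> {vec.span {v} | v. v \<noteq> 0 \<and> vec_eval p v \<noteq> 0}"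
    then obtain v where v: "L = vec.span {v}" "v \<noteq> 0" "vec_eval p v \<noteq> 0" by blast
    have "L \<notin> ?A"
    proof
      assume "L \<in> ?A"
      then obtain w where w: "vec.span {v} = vec.span {w}" "vec_eval p w = 0"
        using v(1) by auto
      then obtain c where "v = c *s w" using line_generator by blast
      then show False using v(3) w(2) d by auto
    qed
    then show "L \<in> topspace zariski_proj - ?A" using v by (auto simp: topspace_zariski_proj)
  qed (auto simp: topspace_zariski_proj)
  then show ?thesis
    using zariski_proj_basic_open[OF p] by (auto simp: closedin_def topspace_zariski_proj)
qed

text \<open>The common zero set of the homogeneous parts of \<open>f\<close>.\<close>

lemma closedin_zariski_proj_lines:
  assumes "polyfun f"
  shows "closedin zariski_proj {vec.span {v} | v. v \<noteq> 0 \<and> (\<forall>t. f (t *s v) = 0)}"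
proof -
  obtain p where p: "f = vec_eval p" using assms by (auto simp: polyfun_iff)
  let ?D = "monom_degree ` Poly_Mapping.keys p"
  let ?A = "\<lambda>d. {vec.span {v} | v. v \<noteq> 0 \<and> vec_eval (hom_part d p) v = 0}"
  have "{vec.span {v} | v. v \<noteq> 0 \<and> (\<forall>t. f (t *s v) = 0)} = topspace zariski_proj \<inter> \<Inter> (?A ` ?D)"
  proof (intro equalityI subsetI)
    fix L assume "L \<in> {vec.span {v} | v. v \<noteq> 0 \<and> (\<forall>t. f (t *s v) = 0)}"
    then obtain v where "L = vec.span {v}" "v \<noteq> 0" "\<And>t. vec_eval p (t *s v) = 0" unfolding p by blast
    with hom_parts_vanish_on_line[of p v]
    show "L \<in> topspace zariski_proj \<inter> \<Inter> (?A ` ?D)" unfolding topspace_zariski_proj by blast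
  next
    fix L assume L: "L \<in> topspace zariski_proj \<inter> \<Inter> (?A ` ?D)"
    then obtain v where v: "L = vec.span {v}" "v \<noteq> 0" unfolding topspace_zariski_proj by blast
    have scale: "vec_eval (hom_part d p) (c *s x) = c ^ d * vec_eval (hom_part d p) x" for c x d
      by (rule homogeneous_degree_scale) (auto dest: keys_hom_part)
    have part: "vec_eval (hom_part d p) v = 0" if "d \<in> ?D" for d
    proof -
      have "L \<in> ?A d" using L that by (elim IntE INT_D)
      then obtain w where w: "vec.span {v} = vec.span {w}" "vec_eval (hom_part d p) w = 0"
        unfolding v(1) by (elim CollectE exE conjE)
      then obtain c where "v = c *s w" using line_generator by blast
      then show ?thesis by (simp only: scale w(2) mult_zero_right)
    qed
    have "vec_eval p (t *s v) = 0" for t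
      by (subst poly_eval_hom_parts, rule sum.neutral, rule ballI)
         (simp only: scale part mult_zero_right)
    then have "\<forall>t. f (t *s v) = 0" unfolding p by blast
    with v show "L \<in> {vec.span {v} | v. v \<noteq> 0 \<and> (\<forall>t. f (t *s v) = 0)}" by blast
  qed
  moreover have "closedin zariski_proj (topspace zariski_proj \<inter> \<Inter> (?A ` ?D))"
  proof (cases "?D = {}")
    case False
    then show ?thesis
      by (intro closedin_Int closedin_topspace closedin_Inter)
         (auto intro: closedin_zariski_proj_zeros homogeneous_hom_part)
  qed simp
  ultimately show ?thesis by simp
qed

section \<open>Affine cones of projective varieties\<close>

lemma affine_cone_iff:
  assumes "X \<subseteq> topspace zariski_proj"
  shows "x \<in> affine_cone X \<longleftrightarrow> x = 0 \<or> vec.span {x} \<in> X"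
proof -
  have "vec.span {x} \<in> X" if L: "L \<in> X" "x \<in> L" "x \<noteq> 0" for L
  proof -
    obtain v where v: "L = vec.span {v}" "v \<noteq> 0"
      using L(1) assms unfolding topspace_zariski_proj by blast
    then obtain c where c: "x = c *s v" using L(2) by (auto simp: vec.span_singleton)
    then have "c \<noteq> 0" using L(3) by auto
    have "vec.span {x} = L"
      unfolding v(1) vec.span_singleton
    proof (intro equalityI subsetI)
      fix y assume "y \<in> range (\<lambda>k. k *s v)"
      then obtain k where "y = k *s v" by blast
      then have "y = (k / c) *s x" using c \<open>c \<noteq> 0\<close> by simp
      then show "y \<in> range (\<lambda>k. k *s x)" by blast
    qed (auto simp: c)
    then show ?thesis using L(1) by simp
  qed
  moreover have "x \<in> vec.span {x}" by (simp add: vec.span_base)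
  ultimately show ?thesis unfolding affine_cone_def by blast
qed

lemma affine_cone_scale:
  assumes "X \<subseteq> topspace zariski_proj" "x \<in> affine_cone X" shows "c *s x \<in> affine_cone X"
proof (cases "x = 0 \<or> c = 0")
  case True
  then show ?thesis by (auto simp: affine_cone_def)
next
  case False
  then have "vec.span {x} \<in> X" using assms affine_cone_iff by blast
  moreover have "c *s x \<in> vec.span {x}" by (auto simp: vec.span_singleton)
  ultimately show ?thesis by (auto simp: affine_cone_def)
qed

text \<open>A line outside \<open>X\<close> is separated from \<open>X\<close> by a homogeneous polynomial. It vanishes on the punctured
  cone, and by homogeneity also at the vertex, which lies on the line through any other point.\<close>

lemma affine_cone_closed:
  assumes X: "subvariety X" and ideal: "\<And>f. f \<in> ideal_of (affine_cone X) \<Longrightarrow> f x = 0"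
    and "X \<noteq> {}"
  shows "x \<in> affine_cone X"
proof (rule ccontr)
  assume x: "x \<notin> affine_cone X"
  have top: "X \<subseteq> topspace zariski_proj" and op: "openin zariski_proj (topspace zariski_proj - X)"
    using X by (auto simp: subvariety_def closedin_def)
  have "x \<noteq> 0" "vec.span {x} \<notin> X" using x affine_cone_iff[OF top] by auto
  then obtain p where p: "homogeneous p" "vec_eval p x \<noteq> 0"
    "\<And>w. w \<noteq> 0 \<Longrightarrow> vec_eval p w \<noteq> 0 \<Longrightarrow> vec.span {w} \<in> topspace zariski_proj - X"
    using zariski_proj_open_contains[OF op, of x] by (auto simp: topspace_zariski_proj)
  obtain d where d: "\<And>c v. vec_eval p (c *s v) = c ^ d * vec_eval p v"
    using homogeneous_scale[OF p(1)] by blast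
  have nz: "vec_eval p w = 0" if "w \<in> affine_cone X" "w \<noteq> 0" for w
    using that p(3)[of w] affine_cone_iff[OF top] by blast
  obtain L where "L \<in> X" using \<open>X \<noteq> {}\<close> by blast
  then obtain v where v: "v \<noteq> 0" "vec.span {v} \<in> X" using top unfolding topspace_zariski_proj by blast
  then have "vec_eval p v = 0" using nz affine_cone_iff[OF top] by blast
  then have "vec_eval p 0 = 0" using d[of 0 v] by simp
  then have "vec_eval p w = 0" if "w \<in> affine_cone X" for w
    using nz[OF that] by (cases "w = 0") auto
  then have "vec_eval p \<in> ideal_of (affine_cone X)"
    unfolding ideal_of_def using polyfun_vec_eval by blast
  then show False using ideal p(2) by blast
qed

text \<open>Every line of \<open>X\<close> is irreducible, so a decomposition of the cone into two closed sets distributes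
  the lines of \<open>X\<close> over two closed subsets of projective space.\<close>

lemma affine_cone_irreducible:
  assumes X: "irreducible_in zariski_proj X" shows "irreducible_in zariski_affine (affine_cone X)"
  unfolding irreducible_in_def
proof (intro conjI allI impI)
  have top: "X \<subseteq> topspace zariski_proj" "X \<noteq> {}" using X by (auto simp: irreducible_in_def)
  fix A B assume AB: "closedin zariski_affine A \<and> closedin zariski_affine B \<and> affine_cone X \<subseteq> A \<union> B"
  show "affine_cone X \<subseteq> A \<or> affine_cone X \<subseteq> B"
  proof (rule ccontr)
    assume "\<not> ?thesis"
    then obtain a b where a: "a \<in> affine_cone X" "a \<notin> A" and b: "b \<in> affine_cone X" "b \<notin> B" by blast
    obtain f where f: "polyfun f" "f a \<noteq> 0" "\<And>v. v \<in> A \<Longrightarrow> f v = 0"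
      using zariski_affine_separate AB a(2) by blast
    obtain g where g: "polyfun g" "g b \<noteq> 0" "\<And>v. v \<in> B \<Longrightarrow> g v = 0"
      using zariski_affine_separate AB b(2) by blast
    let ?V = "\<lambda>f. {vec.span {v} | v :: complex^'a. v \<noteq> 0 \<and> (\<forall>t. f (t *s v) = 0)}"
    have "X \<subseteq> ?V f \<union> ?V g"
    proof
      fix L assume L: "L \<in> X"
      then obtain v where v: "L = vec.span {v}" "v \<noteq> 0" using top unfolding topspace_zariski_proj by blast
      then have "v \<in> affine_cone X" using L affine_cone_iff[OF top(1)] by blast
      then have "f (0 + t *s v) * g (0 + t *s v) = 0" for t
        using affine_cone_scale[OF top(1), of v t] AB f(3) g(3) by auto
      from line_zero_product[OF f(1) g(1) this] v show "L \<in> ?V f \<union> ?V g" by auto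
    qed
    then have "X \<subseteq> ?V f \<or> X \<subseteq> ?V g"
      using X closedin_zariski_proj_lines[OF f(1)] closedin_zariski_proj_lines[OF g(1)]
      unfolding irreducible_in_def by blast
    moreover have "h x = 0" if sub: "X \<subseteq> ?V h" and x: "x \<in> affine_cone X" for h x
    proof -
      obtain L where L: "L \<in> X" "x \<in> L"
      proof (cases "x = 0")
        case True
        obtain L where "L \<in> X" using top(2) by blast
        moreover from this have "0 \<in> L" using top(1) vec.span_zero unfolding topspace_zariski_proj by blast
        ultimately show ?thesis using that True by blast
      qed (use x in \<open>auto simp: affine_cone_def\<close>)
      then obtain v where "L = vec.span {v}" "\<forall>t. h (t *s v) = 0" using sub by blast
      then show ?thesis using L(2) by (auto simp: vec.span_singleton)
    qed
    ultimately show False using f(2) g(2) a(1) b(1) by blast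
  qed
qed (auto simp: affine_cone_def)

text \<open>A complete flag in \<open>W\<close> through \<open>z\<close>, preceded by the point \<open>z\<close>, is a chain of length
  \<open>dim W\<close> of irreducible closed sets, so \<open>Z\<close> cannot be larger than \<open>W\<close>.\<close>

lemma (in symplectic_space) subspace_eq_by_local_dim:
  fixes W Z :: "(complex^'m) set"
  assumes W: "vec.subspace W" "z \<in> W" "z \<noteq> 0" and WZ: "W \<subseteq> Z"
    and Z: "closedin zariski_affine Z" "irreducible_in zariski_affine Z"
    and dim: "local_dim Z z = enat (vec.dim W)"
  shows "W = Z"
proof (rule ccontr)
  assume ne: "W \<noteq> Z"
  have "vec.independent {z}" using W(3) by (simp add: vec.independent_insert)
  then obtain B where B: "{z} \<subseteq> B" "B \<subseteq> W" "vec.independent B" "W \<subseteq> vec.span B"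
    using vec.maximal_independent_subset_extend[of "{z}" W] W(2) by blast
  have span: "vec.span B = W" using B W(1) by (simp add: subset_antisym vec.span_minimal)
  have fin: "finite B" using B(3) by (rule vec.finiteI_independent)
  define n where "n = vec.dim W"
  have n: "n = card B" unfolding n_def span[symmetric] using vec.dim_span_eq_card_independent[OF B(3)] .
  then have n0: "n > 0" using B(1) fin by (auto simp: card_gt_0_iff)
  have "card (B - {z}) = n - 1" using B(1) fin n by simp
  then obtain f where f: "bij_betw f {..<n - 1} (B - {z})"
    using ex_bij_betw_nat_finite[of "B - {z}"] fin by (auto simp: atLeast0LessThan)
  have fB: "insert z (f ` {..<n - 1}) = B" using f B(1) by (auto simp: bij_betw_def)
  \<comment> \<open>\<open>F i\<close> has dimension \<open>i + 1\<close>, so the flag ends with \<open>F (n - 1) = W\<close>, and \<open>C\<close> has the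
    \<open>n + 2\<close> members \<open>{z}, F 0, \<dots>, F (n - 1), Z\<close>.\<close>
  define F where "F i = vec.span (insert z (f ` {..<i}))" for i
  define C where "C j = (case j of 0 \<Rightarrow> {z} | Suc i \<Rightarrow> if i < n then F i else Z)" for j
  have FW: "F i \<subseteq> W" if "i < n" for i
  proof -
    have "insert z (f ` {..<i}) \<subseteq> insert z (f ` {..<n - 1})" using that by auto
    then show ?thesis unfolding F_def span[symmetric] fB by (rule vec.span_mono)
  qed
  have Flast: "F (n - 1) = W" unfolding F_def fB span ..
  have strict: "F i \<subset> F (Suc i)" if "Suc i < n" for i
  proof -
    have i: "i \<in> {..<n - 1}" using that by auto
    have "insert z (f ` {..<i}) \<subseteq> B - {f i}"
    proof -
      have "f i \<noteq> z" using f i by (auto simp: bij_betw_def)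
      moreover have "f j \<noteq> f i" if "j < i" for j
        using f i that by (auto simp: bij_betw_def inj_on_def)
      moreover have "f j \<in> B" if "j < i" for j using fB i that by auto
      ultimately show ?thesis using B(1) by auto
    qed
    then have "F i \<subseteq> vec.span (B - {f i})" unfolding F_def by (rule vec.span_mono)
    moreover have "f i \<in> B" using fB i by blast
    then have "f i \<notin> vec.span (B - {f i})" using B(3) by (auto simp: vec.dependent_def)
    ultimately have "f i \<notin> F i" by blast
    moreover have "f i \<in> F (Suc i)" unfolding F_def by (intro vec.span_base) auto
    moreover have "F i \<subseteq> F (Suc i)" unfolding F_def by (intro vec.span_mono) auto
    ultimately show ?thesis by blast
  qed
  have "\<forall>i\<le>Suc n. closedin zariski_affine (C i) \<and> irreducible_in zariski_affine (C i) \<and>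
      z \<in> C i \<and> C i \<subseteq> Z"
  proof (intro allI impI)
    fix i
    have zZ: "z \<in> Z" using W(2) WZ by blast
    have sub: "vec.subspace (F j)" for j unfolding F_def by (rule vec.subspace_span)
    have "irreducible_in zariski_affine (F j)" for j
      by (rule irreducible_if_lines)
         (use sub[of j] in \<open>auto intro!: vec.subspace_add vec.subspace_scale vec.subspace_diff dest: vec.subspace_0\<close>)
    moreover have "irreducible_in zariski_affine {z}" by (rule irreducible_if_lines) auto
    moreover have "z \<in> F j" for j unfolding F_def by (intro vec.span_base) auto
    ultimately show "closedin zariski_affine (C i) \<and> irreducible_in zariski_affine (C i) \<and>
        z \<in> C i \<and> C i \<subseteq> Z"
      using Z zZ order_trans[OF FW WZ] closedin_zariski_affine_subspace[OF sub]
      by (auto simp: C_def closedin_zariski_affine_singleton split: nat.split)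
  qed
  moreover have "\<forall>i<Suc n. C i \<subset> C (Suc i)"
  proof (intro allI impI)
    fix i assume i: "i < Suc n"
    show "C i \<subset> C (Suc i)"
    proof (cases i)
      case 0
      have "0 \<in> F 0" "z \<in> F 0" unfolding F_def by (auto intro: vec.span_zero vec.span_base)
      then show ?thesis using 0 n0 W(3) by (auto simp: C_def)
    next
      case (Suc j)
      then have "j < n" using i by simp
      show ?thesis
      proof (cases "Suc j < n")
        case True
        then show ?thesis using Suc strict[of j] by (simp add: C_def)
      next
        case False
        then have "j = n - 1" using \<open>j < n\<close> by simp
        have "C i = W" using Suc \<open>j < n\<close> Flast[folded \<open>j = n - 1\<close>] by (simp add: C_def)
        moreover have "C (Suc i) = Z" using Suc False by (simp add: C_def)
        ultimately show ?thesis using WZ ne by simp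
      qed
    qed
  qed
  ultimately have "enat (Suc n) \<le> local_dim Z z"
    unfolding local_dim_def by (intro Sup_upper) blast
  then show False using dim by (simp add: n_def)
qed

section \<open>Compatible operators are scalar\<close>

context legendrian_cone
begin

text \<open>If \<open>F\<close> vanished on \<open>Z\<close>, then its image would be orthogonal to \<open>Z\<close>, and \<open>Z\<close> would be linear.\<close>

lemma exists_nonzero_image:
  assumes F: "compatible F" "F y \<noteq> 0" and nonlinear: "\<not> vec.subspace Z"
  shows "\<exists>x\<in>Z. F x \<noteq> 0"
proof (rule ccontr)
  assume "\<not> ?thesis"
  then have "\<omega> (F y) x = 0" if "x \<in> Z" for x
    using that by (simp add: compatible_adj[OF F(1)])
  then show False using degenerate_linear F(2) nonlinear by blast
qed

text \<open>A non-scalar \<open>B\<close> would produce a quadratic operator \<open>E\<close>. By irreducibility some point \<open>z\<close> of \<open>Z\<close> is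
  generic for it, so the whole tangent space at \<open>z\<close> lies in \<open>Z\<close>; having the same dimension, it is
  \<open>Z\<close>.\<close>

lemma compatible_scalar:
  assumes B: "compatible B" and irr: "irreducible_in zariski_affine Z"
    and smooth: "\<And>x. x \<in> Z \<Longrightarrow> x \<noteq> 0 \<Longrightarrow> smooth_point Z x"
    and nonlinear: "\<not> vec.subspace Z"
  shows "\<exists>a. \<forall>x. B x = a *s x"
proof (rule ccontr)
  assume nonscalar: "\<not> ?thesis"
  interpret B: linear_operator B by (rule linear_operator.intro) (rule compatible_linear[OF B])
  obtain p c where p: "\<And>x. B.op_poly p (B.op_poly p x) = c *s B.op_poly p x"
      "\<exists>x. B.op_poly p x \<noteq> 0" "\<exists>x. B.op_poly p x \<noteq> c *s x"
    using B.quadratic_in_algebra nonscalar by blast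
  define E where "E = B.op_poly p"
  interpret quadratic_operator \<omega> Z E c
    by unfold_locales (use p in \<open>auto simp: E_def intro: compatible_op_poly[OF B]\<close>)
  interpret E': quadratic_operator \<omega> Z "\<lambda>x. E x - c *s x" "- c" by (rule complementary)
  obtain x y where "E x \<noteq> 0" "E y - c *s y \<noteq> 0" using p by (auto simp: E_def)
  then have nonzero: "\<exists>x\<in>Z. E x \<noteq> 0" "\<exists>x\<in>Z. E x - c *s x \<noteq> 0"
    using exists_nonzero_image[OF compat _ nonlinear] exists_nonzero_image[OF E'.compat _ nonlinear]
    by blast+
  have "\<exists>z. generic z"
  proof (rule ccontr)
    assume "\<nexists>z. generic z"
    then have "Z \<subseteq> {x. E x = 0} \<union> {x. E x - c *s x = 0}" by (auto simp: generic_def)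
    moreover have "closedin zariski_affine {x. E x = 0}" "closedin zariski_affine {x. E x - c *s x = 0}"
      by (intro closedin_zariski_affine_kernel compatible_linear compat E'.compat)+
    ultimately have "Z \<subseteq> {x. E x = 0} \<or> Z \<subseteq> {x. E x - c *s x = 0}"
      using irr unfolding irreducible_in_def by blast
    then show False using nonzero by blast
  qed
  then obtain z where z: "generic z" ..
  then have zZ: "z \<in> Z" "z \<noteq> 0" using generic_nonzero by (auto simp: generic_def)
  have "Z = {v. \<forall>f\<in>I. f v = 0}" using closed I_zero by blast
  moreover have "closedin zariski_affine {v. \<forall>f\<in>I. f v = 0}"
    by (rule closedin_zariski_affine_common_zeros) (rule I_polyfun)
  ultimately have "closedin zariski_affine Z" by simp
  then have "T z = Z"
    using subspace_eq_by_local_dim[OF subspace_tangent_space radial_tangent[OF zZ(1)] zZ(2) tangent_subset[OF z]]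
      irr smooth[OF zZ] by (simp add: smooth_point_def)
  then show False using nonlinear subspace_tangent_space[of Z z] by simp
qed

lemma linear_image_tangent:
  assumes g: "Vector_Spaces.linear (*s) (*s) g" "\<And>x. x \<in> Z \<Longrightarrow> g x \<in> Z" and u: "u \<in> T x"
  shows "g u \<in> T (g x)"
proof -
  have "dderiv (g u) f (g x) = 0" if f: "f \<in> I" for f
  proof -
    have "(\<lambda>x. f (g x)) \<in> I"
      using f g by (auto simp: ideal_of_def polyfun_compose_linear)
    then show ?thesis
      using T_zero[OF u] by (simp add: dderiv_compose_linear[OF I_polyfun[OF f] g(1), symmetric])
  qed
  then show ?thesis by (simp add: tangent_space_iff)
qed

text \<open>Write the pulled back form as \<open>\<omega> (B u) v\<close>. As \<open>g\<close> maps tangent spaces to tangent spaces, these are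
  isotropic for the pulled back form, which means that \<open>B\<close> is compatible.\<close>

lemma symplectic_up_to_scalar:
  assumes g: "Vector_Spaces.linear (*s) (*s) g" "\<And>x. x \<in> Z \<Longrightarrow> g x \<in> Z" "inj g"
    and irr: "irreducible_in zariski_affine Z"
    and smooth: "\<And>x. x \<in> Z \<Longrightarrow> x \<noteq> 0 \<Longrightarrow> smooth_point Z x"
    and nonlinear: "\<not> vec.subspace Z"
  shows "\<exists>a. \<forall>u v. \<omega> (g u) (g v) = a * \<omega> u v"
proof -
  interpret g: Vector_Spaces.linear "(*s)" "(*s)" g by fact
  have "\<exists>h. \<forall>v. \<omega> h v = \<omega> (g u) (g v)" for u
    by (rule represent_functional, rule linear_formI)
       (simp_all add: g.add g.scale add_right scale_right)
  then obtain B where B: "\<And>u v. \<omega> (B u) v = \<omega> (g u) (g v)" by metis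
  have "Vector_Spaces.linear (*s) (*s) B"
    unfolding Vector_Spaces.linear_iff
    by (intro conjI allI vec.vector_space_axioms; rule eqI)
       (simp_all add: B g.add g.scale add_left scale_left)
  moreover have "\<omega> (B u) v = \<omega> u (B v)" for u v
    using antisym[of u "B v"] antisym[of "g u" "g v"] by (simp add: B)
  moreover have "B u \<in> T x" if x: "x \<in> Z" "x \<noteq> 0" and u: "u \<in> T x" for x u
  proof (rule lagrangian_perpI[OF lagrangian_tangent[OF x]])
    fix v assume v: "v \<in> T x"
    have "g x \<noteq> 0" using x(2) \<open>inj g\<close> g.zero by (metis injD)
    then have "\<omega> (g u) (g v) = 0"
      using lagrangian_perpD[OF lagrangian_tangent[OF g(2)[OF x(1)]]] linear_image_tangent[OF g(1,2)] u v
      by blast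
    then show "\<omega> (B u) v = 0" by (simp add: B)
  qed
  ultimately have "compatible B" by (simp add: compatible_def self_adjoint_def)
  then obtain a where "\<And>x. B x = a *s x" using compatible_scalar[OF _ irr smooth nonlinear] by blast
  then show ?thesis using B by (metis scale_left)
qed

end

section \<open>The projective linear group\<close>

lemma to_PGL_eq: "to_PGL A = {mat c ** A | c. c \<noteq> 0}"
  by (auto simp: to_PGL_def r_coset_def GL_def scalars_def)

lemma PGL_representative:
  assumes "K \<in> carrier PGL" obtains A where "invertible A" "K = to_PGL A"
  using assms by (auto simp: PGL_def FactGroup_def RCOSETS_def to_PGL_def GL_def)

lemma mat_mult_vec: "mat c *v x = c *s (x :: complex^'m)"
  by (simp add: vec_eq_iff matrix_vector_mult_def mat_def if_distrib[of "\<lambda>x. x * _"] cong: if_cong)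

lemma mat_mult_mat: "mat c ** mat d = (mat (c * d) :: complex^'m^'m)"
  by (simp add: vec_eq_iff matrix_matrix_mult_def mat_def if_distrib[of "\<lambda>x. x * _"] cong: if_cong)

lemma to_PGL_scale:
  assumes "c \<noteq> 0" shows "to_PGL (mat c ** A) = to_PGL A"
proof -
  have "mat d ** (mat c ** A) = mat (d * c) ** A" for d
    by (simp add: matrix_mul_assoc mat_mult_mat)
  then have "to_PGL (mat c ** A) = {mat (d * c) ** A | d. d \<noteq> 0}"
    unfolding to_PGL_eq by simp
  also have "\<dots> = (\<lambda>d. mat d ** A) ` {d * c | d. d \<noteq> 0}" by blast
  also have "{d * c | d. d \<noteq> 0} = {d. d \<noteq> 0}"
  proof (intro equalityI subsetI)
    fix d :: complex assume "d \<in> {d. d \<noteq> 0}"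
    then have "d = d / c * c" "d / c \<noteq> 0" using assms by auto
    then show "d \<in> {d * c | d. d \<noteq> 0}" by blast
  qed (use assms in auto)
  also have "(\<lambda>d. mat d ** A) ` {d. d \<noteq> 0} = to_PGL A" unfolding to_PGL_eq by blast
  finally show ?thesis .
qed

lemma preserves_affine_cone:
  assumes top: "X \<subseteq> topspace zariski_proj" and pres: "PGL_act (to_PGL A) ` X = X"
    and x: "x \<in> affine_cone X"
  shows "A *v x \<in> affine_cone X"
proof (cases "x = 0")
  case False
  have "vec.span {x} \<in> X" using x False affine_cone_iff[OF top] by blast
  then have "PGL_act (to_PGL A) (vec.span {x}) \<in> X" using pres by blast
  moreover have "A \<in> to_PGL A" unfolding to_PGL_eq
    by (intro CollectI exI[of _ 1]) simp
  then have "A *v x \<in> PGL_act (to_PGL A) (vec.span {x})"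
    unfolding PGL_act_def using vec.span_base[of x "{x}"] by blast
  ultimately show ?thesis by (auto simp: affine_cone_def)
qed (simp add: affine_cone_def)

text \<open>A representative of an element of \<open>G\<close> scales \<open>\<omega>\<close> by some factor \<open>a\<close>; dividing it by a square root
  of \<open>a\<close> changes neither its class nor its action on lines and makes it symplectic.\<close>

theorem theorem1p4:
  fixes n :: nat
    and \<omega> :: "complex^'m \<Rightarrow> complex^'m \<Rightarrow> complex"
    and X :: "(complex^'m) set set"
    and G :: "(complex^'m^'m) set set"
  assumes "CARD('m) = 2 * n"
    and "symplectic_form \<omega>"
    and "subvariety X"
    and "irreducible_in zariski_proj X"
    and "smooth_subvariety X"
    and "legendrian \<omega> X"
    and "\<not> linear_subvariety X"
    and "subgroup G PGL"
    and "connectedin zariski_PGL G"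
    and "preserves G X"
  shows "G \<subseteq> to_PGL ` Sp \<omega>"
proof
  fix K assume K: "K \<in> G"
  let ?Z = "affine_cone X"
  have top: "X \<subseteq> topspace zariski_proj" and "X \<noteq> {}"
    using assms(4) by (auto simp: irreducible_in_def)
  obtain L where "L \<in> X" using \<open>X \<noteq> {}\<close> by blast
  then obtain v0 where v0: "v0 \<noteq> 0" "vec.span {v0} \<in> X" using top unfolding topspace_zariski_proj by blast
  have smooth: "smooth_point ?Z x" if "x \<in> ?Z" "x \<noteq> 0" for x
    using assms(5) that by (auto simp: smooth_subvariety_def)
  interpret legendrian_cone \<omega> ?Z
  proof unfold_locales
    show "symplectic_form \<omega>" by fact
    show "\<exists>x\<in>?Z. x \<noteq> 0" using v0 affine_cone_iff[OF top] by blast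
    show "c *s x \<in> ?Z" if "x \<in> ?Z" for c x using affine_cone_scale[OF top that] .
    show "x \<in> ?Z" if "\<And>f. f \<in> ideal_of ?Z \<Longrightarrow> f x = 0" for x
      using affine_cone_closed[OF assms(3) that \<open>X \<noteq> {}\<close>] .
    show "lagrangian \<omega> (tangent_space ?Z x)" if "x \<in> ?Z" "x \<noteq> 0" for x
      using assms(6) smooth[OF that] by (simp add: legendrian_def)
  qed
  have nonlinear: "\<not> vec.subspace ?Z"
  proof
    assume "vec.subspace ?Z"
    moreover have "X = proj ?Z"
      unfolding proj_def
    proof (intro equalityI subsetI)
      fix L assume "L \<in> X"
      moreover from this obtain v where "L = vec.span {v}" "v \<noteq> 0"
        using top unfolding topspace_zariski_proj by blast
      ultimately show "L \<in> {vec.span {v} | v. v \<in> ?Z \<and> v \<noteq> 0}" using affine_cone_iff[OF top] by blast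
    next
      fix L assume "L \<in> {vec.span {v} | v. v \<in> ?Z \<and> v \<noteq> 0}"
      then show "L \<in> X" using affine_cone_iff[OF top] by blast
    qed
    ultimately show False using assms(7) by (auto simp: linear_subvariety_def)
  qed
  have "K \<in> carrier PGL" using subgroup.subset[OF assms(8)] K by blast
  then obtain A where A: "invertible A" "K = to_PGL A" by (rule PGL_representative)
  have inj: "inj ((*v) A)" using A(1) by (simp add: inj_matrix_vector_mult)
  have pres: "PGL_act (to_PGL A) ` X = X" using assms(10) K A(2) by (auto simp: preserves_def)
  obtain a where a: "\<And>u v. \<omega> (A *v u) (A *v v) = a * \<omega> u v"
    using symplectic_up_to_scalar[OF matrix_vector_mul_linear_gen preserves_affine_cone[OF top pres] inj
        affine_cone_irreducible[OF assms(4)] smooth nonlinear] by blast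
  have "a \<noteq> 0"
  proof
    assume "a = 0"
    have "\<omega> (A *v v0) w = 0" for w
    proof -
      obtain A' where "A ** A' = mat 1" using A(1) by (auto simp: invertible_def)
      then have "w = A *v (A' *v w)" by (simp add: matrix_vector_mul_assoc)
      then show ?thesis using a[of v0 "A' *v w"] \<open>a = 0\<close> by simp
    qed
    then have "A *v v0 = 0" by (rule nondegenerate)
    then show False using injD[OF inj, of v0 0] v0(1) by simp
  qed
  define b where "b = csqrt a"
  have b: "b * b = a" "b \<noteq> 0" using \<open>a \<noteq> 0\<close> by (simp_all add: b_def flip: power2_eq_square)
  let ?A = "mat (1 / b) ** A"
  have scale: "?A *v u = (1 / b) *s (A *v u)" for u
    by (simp add: matrix_vector_mul_assoc[symmetric] mat_mult_vec)
  have "invertible (mat (1 / b) :: complex^'m^'m)"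
    unfolding invertible_def using b(2) by (intro exI[of _ "mat b"]) (simp add: mat_mult_mat)
  then have "invertible ?A" using A(1) by (rule invertible_mult)
  moreover have "\<omega> (?A *v u) (?A *v v) = \<omega> u v" for u v
    using b \<open>a \<noteq> 0\<close> by (simp add: scale scale_left scale_right a field_simps)
  ultimately have "?A \<in> Sp \<omega>" by (simp add: Sp_def)
  moreover have "K = to_PGL ?A" using A(2) b(2) by (simp add: to_PGL_scale)
  ultimately show "K \<in> to_PGL ` Sp \<omega>" by blast
qed

end
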